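(* Let $n\ge1$ and let $T=(T_{ij})_{i,j=1}^n$ be an $n\times n$ operator matrix with $T_{ij}\in B(\mathbb{H})$. Let $f,g$ be non-negative continuous functions on $[0,\infty)$ with $f(t)g(t)=t$ for all $t\in[0,\infty)$. Let $T''=(t''_{ij})$ be the $n\times n$ complex matrix with \[ t''_{ij}=\begin{cases}\frac12\big\|f^2(|T_{ii}|)+g^2(|T_{ii}^*|)\big\|, & i=j,\\ \|f^2(|T_{ij}|)\|^{1/2}\|g^2(|T_{ij}^*|)\|^{1/2}, & i\ne j.\end{cases} \] Then $w(T)\le w(T'')$.
   Context: $\mathbb{H}$ is a complex Hilbert space and $B(\mathbb{H})$ the algebra of bounded linear operators on it. An $n\times n$ operator matrix $(T_{ij})$ with $T_{ij}\in B(\mathbb{H})$ is regarded as an operator on $\oplus_{i=1}^n\mathbb{H}$. For an operator $S$ on a Hilbert space, $\|S\|$ is the operator norm, $w(S)=\sup\{|\langle Sx,x\rangle|:\|x\|=1\}$ the numerical radius (for a complex matrix, computed on $\mathbb{C}^n$), and $|S|=(S^*S)^{1/2}$. For a positive operator $P$ and continuous $h$ on $[0,\infty)$, $h(P)$ is defined by continuous functional calculus and $h^2(P)=(h(P))^2$. *)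

theory Defs
  imports "HOL-Analysis.Analysis" "HOL-Computational_Algebra.Polynomial"
begin

text \<open>A complex Hilbert space is modelled by a type 'a (abelian group) together with
 a complex scalar multiplication sc and an inner product ip, linear in the first argument
 and conjugate linear in the second, complete w.r.t. the induced norm.\<close>

definition hnorm :: "('a \<Rightarrow> 'a \<Rightarrow> complex) \<Rightarrow> 'a \<Rightarrow> real" where
  "hnorm ip x = sqrt (Re (ip x x))"

definition chilbert :: "(complex \<Rightarrow> 'a::ab_group_add \<Rightarrow> 'a) \<Rightarrow> ('a \<Rightarrow> 'a \<Rightarrow> complex) \<Rightarrow> bool" where
  "chilbert sc ip \<longleftrightarrow>
     (\<forall>x. sc 1 x = x) \<and> (\<forall>a b x. sc a (sc b x) = sc (a * b) x) \<and>
     (\<forall>a x y. sc a (x + y) = sc a x + sc a y) \<and> (\<forall>a b x. sc (a + b) x = sc a x + sc b x) \<and>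
     (\<forall>x y z. ip (x + y) z = ip x z + ip y z) \<and> (\<forall>a x y. ip (sc a x) y = a * ip x y) \<and>
     (\<forall>x y. ip y x = cnj (ip x y)) \<and> (\<forall>x. Im (ip x x) = 0 \<and> Re (ip x x) \<ge> 0) \<and>
     (\<forall>x. ip x x = 0 \<longrightarrow> x = 0) \<and>
     (\<forall>X::nat \<Rightarrow> 'a. (\<forall>e>0. \<exists>N. \<forall>m\<ge>N. \<forall>k\<ge>N. hnorm ip (X m - X k) < e)
        \<longrightarrow> (\<exists>L. (\<lambda>k. hnorm ip (X k - L)) \<longlonglongrightarrow> 0))"

definition bop :: "(complex \<Rightarrow> 'a::ab_group_add \<Rightarrow> 'a) \<Rightarrow> ('a \<Rightarrow> 'a \<Rightarrow> complex) \<Rightarrow> ('a \<Rightarrow> 'a) \<Rightarrow> bool" where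
  "bop sc ip T \<longleftrightarrow> (\<forall>x y. T (x + y) = T x + T y) \<and> (\<forall>a x. T (sc a x) = sc a (T x)) \<and>
     (\<exists>K. \<forall>x. hnorm ip (T x) \<le> K * hnorm ip x)"

definition opnorm :: "('a \<Rightarrow> 'a \<Rightarrow> complex) \<Rightarrow> ('a \<Rightarrow> 'a) \<Rightarrow> real" where
  "opnorm ip T = Sup (insert 0 {hnorm ip (T x) | x. hnorm ip x \<le> 1})"

definition adj :: "('a \<Rightarrow> 'a \<Rightarrow> complex) \<Rightarrow> ('a \<Rightarrow> 'a) \<Rightarrow> ('a \<Rightarrow> 'a)" where
  "adj ip T = (\<lambda>y. THE z. \<forall>x. ip (T x) y = ip x z)"

definition peval :: "(complex \<Rightarrow> 'a::ab_group_add \<Rightarrow> 'a) \<Rightarrow> real poly \<Rightarrow> ('a \<Rightarrow> 'a) \<Rightarrow> ('a \<Rightarrow> 'a)" where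
  "peval sc q P = (\<lambda>x. \<Sum>i\<le>degree q. sc (complex_of_real (coeff q i)) ((P ^^ i) x))"

text \<open>Continuous functional calculus h(P) for a positive operator P (whose spectrum lies in
 [0, norm P]): the operator-norm limit of p_k(P) for any polynomials p_k converging uniformly
 to h on [0, norm P].\<close>
definition fcalc :: "(complex \<Rightarrow> 'a::ab_group_add \<Rightarrow> 'a) \<Rightarrow> ('a \<Rightarrow> 'a \<Rightarrow> complex) \<Rightarrow> (real \<Rightarrow> real) \<Rightarrow> ('a \<Rightarrow> 'a) \<Rightarrow> ('a \<Rightarrow> 'a)" where
  "fcalc sc ip h P = (THE L. bop sc ip L \<and>
     (\<forall>p :: nat \<Rightarrow> real poly.
        (\<forall>e>0. \<exists>N. \<forall>k\<ge>N. \<forall>t\<in>{0..opnorm ip P}. \<bar>poly (p k) t - h t\<bar> < e)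
        \<longrightarrow> (\<lambda>k. opnorm ip (\<lambda>x. peval sc (p k) P x - L x)) \<longlonglongrightarrow> 0))"

definition absop :: "(complex \<Rightarrow> 'a::ab_group_add \<Rightarrow> 'a) \<Rightarrow> ('a \<Rightarrow> 'a \<Rightarrow> complex) \<Rightarrow> ('a \<Rightarrow> 'a) \<Rightarrow> ('a \<Rightarrow> 'a)" where
  "absop sc ip S = fcalc sc ip sqrt (adj ip S \<circ> S)"

definition fcalc_sq :: "(complex \<Rightarrow> 'a::ab_group_add \<Rightarrow> 'a) \<Rightarrow> ('a \<Rightarrow> 'a \<Rightarrow> complex) \<Rightarrow> (real \<Rightarrow> real) \<Rightarrow> ('a \<Rightarrow> 'a) \<Rightarrow> ('a \<Rightarrow> 'a)" where
  "fcalc_sq sc ip h P = fcalc sc ip h P \<circ> fcalc sc ip h P"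

text \<open>Numerical radius of the n x n operator matrix (T i j) acting on the direct sum of n
 copies of H (entries with indices outside {..<n} are irrelevant).\<close>
definition wopmat :: "('a \<Rightarrow> 'a \<Rightarrow> complex) \<Rightarrow> nat \<Rightarrow> (nat \<Rightarrow> nat \<Rightarrow> 'a \<Rightarrow> 'a::ab_group_add) \<Rightarrow> real" where
  "wopmat ip n T = Sup (insert 0 {cmod (\<Sum>i<n. \<Sum>j<n. ip (T i j (x j)) (x i)) | x.
        (\<Sum>i<n. (hnorm ip (x i))\<^sup>2) = 1})"

definition wmat :: "nat \<Rightarrow> (nat \<Rightarrow> nat \<Rightarrow> complex) \<Rightarrow> real" where
  "wmat n M = Sup (insert 0 {cmod (\<Sum>i<n. \<Sum>j<n. M i j * z j * cnj (z i)) | z.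
        (\<Sum>i<n. (cmod (z i))\<^sup>2) = 1})"

end

theory Submission
  imports Defs "HOL-Computational_Algebra.Fundamental_Theorem_Algebra"
begin

text \<open>The mixed Schwarz inequality \<open>|\<langle>S x, y\<rangle>| \<le> \<parallel>f(|S|) x\<parallel> \<parallel>g(|S\<^sup>*|) y\<parallel>\<close> bounds the entry
  \<open>|\<langle>T\<^sub>i\<^sub>j x\<^sub>j, x\<^sub>i\<rangle>|\<close> by \<open>t''\<^sub>i\<^sub>j \<parallel>x\<^sub>j\<parallel> \<parallel>x\<^sub>i\<parallel>\<close> (on the diagonal after the inequality between
  arithmetic and geometric mean), and \<open>(\<parallel>x\<^sub>1\<parallel>, \<dots>, \<parallel>x\<^sub>n\<parallel>)\<close> is a unit vector of
  \<open>\<complex>\<^sup>n\<close>. The functional calculus rests on \<open>\<parallel>p(P)\<parallel> \<le> max |p|\<close> over \<open>[0, \<parallel>P\<parallel>]\<close> for positive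
  \<open>P\<close> and real polynomials \<open>p\<close>, which follows by splitting a polynomial into linear
  factors.\<close>

text \<open>The definite descriptions in the definitions have to be earned: \<open>adj\<close>
  requires the Riesz theorem, and \<open>fcalc\<close> requires a unique bounded operator that is
  the limit along every admissible sequence of polynomials. The algebraic rules of the calculus then
  all come from one quantitative fact: a polynomial within \<open>e\<close> of \<open>h\<close> on
  \<open>[0, norm P]\<close> gives an operator within \<open>e\<close> of \<open>h(P)\<close>. This
  explains the interval in the norm bound, which is the one that \<open>fcalc\<close> prescribes and
  may be larger than the spectrum. Splitting a real polynomial into linear factors forces a detour
  through complex coefficients. The diagonal entries of \<open>T''\<close> can be smaller than the
  off-diagonal formula would give, because on the diagonal the same vector stands on both sides of
  the inner product.\<close>

lemma weierstrass_poly: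
  fixes h :: "real \<Rightarrow> real"
  assumes "continuous_on {0..M} h" "e > 0"
  obtains p where "\<And>t. 0 \<le> t \<Longrightarrow> t \<le> M \<Longrightarrow> \<bar>poly p t - h t\<bar> \<le> e"
proof -
  obtain q where q: "real_polynomial_function q" "\<And>t. t \<in> {0..M} \<Longrightarrow> \<bar>h t - q t\<bar> < e"
    using Stone_Weierstrass_real_polynomial_function[OF compact_Icc assms] by blast
  then obtain a n where a: "q = (\<lambda>t. \<Sum>i\<le>n. a i * t ^ i)"
    by (auto simp: real_polynomial_function_iff_sum)
  have "poly (\<Sum>i\<le>n. monom (a i) i) t = q t" for t
    by (simp add: a poly_sum poly_monom)
  then show thesis
    using q(2) by (intro that[of "\<Sum>i\<le>n. monom (a i) i"]) (force simp: abs_minus_commute)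
qed

locale hilbert_space = vector_space sc
  for sc :: "complex \<Rightarrow> 'a::ab_group_add \<Rightarrow> 'a" +
  fixes ip :: "'a \<Rightarrow> 'a \<Rightarrow> complex"
  assumes chilbert: "chilbert sc ip"
begin

abbreviation nrm :: "'a \<Rightarrow> real" where "nrm \<equiv> hnorm ip"
abbreviation bounded_op :: "('a \<Rightarrow> 'a) \<Rightarrow> bool" where "bounded_op \<equiv> bop sc ip"

subsection \<open>Inner product and norm\<close>

lemma ip_axioms:
  "(\<forall>x y z. ip (x + y) z = ip x z + ip y z) \<and> (\<forall>a x y. ip (sc a x) y = a * ip x y) \<and>
   (\<forall>x y. ip y x = cnj (ip x y)) \<and> (\<forall>x. Im (ip x x) = 0 \<and> Re (ip x x) \<ge> 0) \<and>
   (\<forall>x. ip x x = 0 \<longrightarrow> x = 0)"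
  using chilbert unfolding chilbert_def by (elim conjE) (intro conjI; assumption)

lemma ip_add_left: "ip (x + y) z = ip x z + ip y z"
  and ip_scale_left: "ip (sc a x) y = a * ip x y"
  and ip_commute: "ip y x = cnj (ip x y)"
  and Im_ip_self [simp]: "Im (ip x x) = 0"
  and Re_ip_self_nonneg [simp]: "Re (ip x x) \<ge> 0"
  and ip_self_eq_0D: "ip x x = 0 \<Longrightarrow> x = 0"
proof -
  note ax = ip_axioms
  show "ip (x + y) z = ip x z + ip y z" using ax[THEN conjunct1] by iprover
  note ax = ax[THEN conjunct2]
  show "ip (sc a x) y = a * ip x y" using ax[THEN conjunct1] by iprover
  note ax = ax[THEN conjunct2]
  show "ip y x = cnj (ip x y)" using ax[THEN conjunct1] by iprover
  note ax = ax[THEN conjunct2]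
  show "Im (ip x x) = 0" "Re (ip x x) \<ge> 0" using ax[THEN conjunct1] by iprover+
  show "ip x x = 0 \<Longrightarrow> x = 0" using ax[THEN conjunct2] by iprover
qed

lemma complete:
  fixes X :: "nat \<Rightarrow> 'a"
  assumes "\<And>e. e > 0 \<Longrightarrow> \<exists>N. \<forall>m\<ge>N. \<forall>k\<ge>N. nrm (X m - X k) < e"
  obtains L where "(\<lambda>k. nrm (X k - L)) \<longlonglongrightarrow> 0"
proof -
  have "(\<forall>e>0. \<exists>N. \<forall>m\<ge>N. \<forall>k\<ge>N. hnorm ip (X m - X k) < e)
        \<longrightarrow> (\<exists>L. (\<lambda>k. hnorm ip (X k - L)) \<longlonglongrightarrow> 0)"
    using chilbert unfolding chilbert_def by (elim conjE) (erule spec)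
  then show thesis using assms that by blast
qed

lemma ip_add_right: "ip x (y + z) = ip x y + ip x z"
  by (metis ip_add_left ip_commute complex_cnj_add)

lemma ip_scale_right: "ip x (sc a y) = cnj a * ip x y"
  by (metis ip_scale_left ip_commute complex_cnj_mult)

lemma ip_zero_left [simp]: "ip 0 y = 0"
  using ip_add_left[of 0 0 y] by simp

lemma ip_zero_right [simp]: "ip x 0 = 0"
  using ip_add_right[of x 0 0] by simp

lemma ip_minus_left: "ip (- x) y = - ip x y"
  using ip_add_left[of "- x" x y] by (simp add: add_eq_0_iff2)

lemma ip_minus_right: "ip x (- y) = - ip x y"
  using ip_add_right[of x "- y" y] by (simp add: add_eq_0_iff2)

lemma ip_diff_left: "ip (x - y) z = ip x z - ip y z"
  using ip_add_left[of x "- y" z] by (simp add: ip_minus_left)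

lemma ip_diff_right: "ip x (y - z) = ip x y - ip x z"
  using ip_add_right[of x y "- z"] by (simp add: ip_minus_right)

lemma nrm_nonneg [simp]: "0 \<le> nrm x"
  by (simp add: hnorm_def)

lemma nrm_sq: "(nrm x)\<^sup>2 = Re (ip x x)"
  by (simp add: hnorm_def)

lemma ip_self: "ip x x = complex_of_real ((nrm x)\<^sup>2)"
  by (simp add: nrm_sq complex_eq_iff)

lemma nrm_zero [simp]: "nrm 0 = 0"
  by (simp add: hnorm_def)

lemma nrm_eq_0 [simp]: "nrm x = 0 \<longleftrightarrow> x = 0"
  using ip_self_eq_0D[of x] by (auto simp: ip_self)

lemma nrm_scale: "nrm (sc a x) = cmod a * nrm x"
proof -
  have "ip (sc a x) (sc a x) = (a * cnj a) * ip x x"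
    by (simp add: ip_scale_left ip_scale_right)
  also have "a * cnj a = complex_of_real ((cmod a)\<^sup>2)"
    by (simp only: complex_norm_square)
  finally have "(nrm (sc a x))\<^sup>2 = (cmod a * nrm x)\<^sup>2"
    by (simp add: nrm_sq power_mult_distrib)
  then show ?thesis by (simp add: power2_eq_iff_nonneg)
qed

lemma nrm_minus: "nrm (- x) = nrm x"
  by (simp add: hnorm_def ip_minus_left ip_minus_right)

lemma nrm_minus_commute: "nrm (x - y) = nrm (y - x)"
  by (metis nrm_minus minus_diff_eq)

lemma cauchy_schwarz: "cmod (ip x y) \<le> nrm x * nrm y"
proof (cases "y = 0")
  case False
  then have ny: "nrm y > 0" using nrm_nonneg[of y] by (metis nrm_eq_0 order_le_less)
  define c where "c = ip x y / complex_of_real ((nrm y)\<^sup>2)"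
  \<comment> \<open>\<open>sc c y\<close> is the orthogonal projection of \<open>x\<close> onto the
    line through \<open>y\<close>; the inequality says that the remainder \<open>z\<close> has
    nonnegative square norm.\<close>
  define z where "z = x - sc c y"
  have yy: "ip y y \<noteq> 0" using False ip_self_eq_0D by blast
  have c: "c * ip y y = ip x y" using yy by (simp add: c_def ip_self)
  have "ip z y = 0" by (simp add: z_def ip_diff_left ip_scale_left c)
  then have "ip z z = ip z x"
    by (simp add: z_def ip_diff_right ip_scale_right)
  also have "\<dots> = ip x x - c * ip y x" by (simp add: z_def ip_diff_left ip_scale_left)
  also have "c * ip y x = complex_of_real ((cmod (ip x y))\<^sup>2 / (nrm y)\<^sup>2)"
    unfolding c_def ip_commute[of y x] of_real_divide complex_norm_square by simp
  finally have "Re (ip z z) = (nrm x)\<^sup>2 - (cmod (ip x y))\<^sup>2 / (nrm y)\<^sup>2"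
    by (simp add: nrm_sq)
  then have "(cmod (ip x y))\<^sup>2 / (nrm y)\<^sup>2 \<le> (nrm x)\<^sup>2"
    by (metis Re_ip_self_nonneg diff_ge_0_iff_ge)
  then have "(cmod (ip x y))\<^sup>2 \<le> (nrm x * nrm y)\<^sup>2"
    using zero_less_power[OF ny, of 2] by (simp only: pos_divide_le_eq power_mult_distrib)
  then show ?thesis by (rule power2_le_imp_le) simp
qed simp

lemma nrm_add_sq: "(nrm (x + y))\<^sup>2 = (nrm x)\<^sup>2 + 2 * Re (ip x y) + (nrm y)\<^sup>2"
  using ip_commute[of y x] by (simp add: nrm_sq ip_add_left ip_add_right)

lemma nrm_triangle: "nrm (x + y) \<le> nrm x + nrm y"
proof (rule power2_le_imp_le)
  have "Re (ip x y) \<le> nrm x * nrm y"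
    using cauchy_schwarz[of x y] complex_Re_le_cmod order_trans by blast
  then show "(nrm (x + y))\<^sup>2 \<le> (nrm x + nrm y)\<^sup>2"
    by (simp add: nrm_add_sq power2_sum)
qed simp

lemma nrm_triangle_diff: "nrm (x - y) \<le> nrm x + nrm y"
  using nrm_triangle[of x "- y"] by (simp add: nrm_minus)

lemma nrm_triangle_mid: "nrm (x - z) \<le> nrm (x - y) + nrm (y - z)"
  using nrm_triangle[of "x - y" "y - z"] by simp

lemma nrm_triangle_rev: "\<bar>nrm x - nrm y\<bar> \<le> nrm (x - y)"
  using nrm_triangle[of "x - y" y] nrm_triangle[of "y - x" x] nrm_minus_commute[of x y]
  by simp

text \<open>The common end of all approximation arguments below. Restricting to
  \<open>e \<le> 1\<close> lets estimates with a term quadratic in \<open>e\<close> be written with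
  a constant times \<open>e\<close>.\<close>

lemma eq_if_nrm_le_eps:
  assumes "\<And>e::real. 0 < e \<Longrightarrow> e \<le> 1 \<Longrightarrow> nrm (x - y) \<le> e * c"
  shows "x = y"
proof -
  have "nrm (x - y) \<le> 0"
  proof (rule ccontr)
    assume "\<not> nrm (x - y) \<le> 0"
    then have p: "nrm (x - y) > 0" by simp
    then have c: "c > 0" using assms[of 1] by simp
    \<comment> \<open>Small enough that \<open>e * c\<close> is at most half of the supposedly
      positive norm.\<close>
    define e where "e = min 1 (nrm (x - y) / (2 * c))"
    have "e * c \<le> nrm (x - y) / (2 * c) * c"
      unfolding e_def using c by (intro mult_right_mono) auto
    also have "\<dots> < nrm (x - y)" using p c by simp
    finally show False using assms[of e] p c by (simp add: e_def)
  qed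
  then show ?thesis using nrm_nonneg[of "x - y"] by (metis order_antisym nrm_eq_0 right_minus_eq)
qed

lemma ip_cancel_right:
  assumes "\<And>x. ip x y = ip x z"
  shows "y = z"
  using assms[of "y - z"] ip_self_eq_0D[of "y - z"] by (simp add: ip_diff_right)

subsection \<open>Bounded operators\<close>

lemma bounded_op_add: "bounded_op S \<Longrightarrow> S (x + y) = S x + S y"
  and bounded_op_scale: "bounded_op S \<Longrightarrow> S (sc a x) = sc a (S x)"
  by (simp_all add: bop_def)

lemma bounded_op_zero: "bounded_op S \<Longrightarrow> S 0 = 0"
  using bounded_op_add[of S 0 0] by simp

lemma bounded_op_minus: "bounded_op S \<Longrightarrow> S (- x) = - S x"
  using bounded_op_add[of S "- x" x] by (simp add: bounded_op_zero add_eq_0_iff2)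

lemma bounded_op_diff: "bounded_op S \<Longrightarrow> S (x - y) = S x - S y"
  using bounded_op_add[of S x "- y"] by (simp add: bounded_op_minus)

lemma bounded_opI:
  assumes "\<And>x y. S (x + y) = S x + S y" "\<And>a x. S (sc a x) = sc a (S x)"
    "\<And>x. nrm (S x) \<le> K * nrm x"
  shows "bounded_op S"
  using assms unfolding bop_def by blast

lemma opnorm_nonneg_bound:
  assumes "bounded_op S"
  shows "0 \<le> opnorm ip S" and "nrm (S x) \<le> opnorm ip S * nrm x"
proof -
  obtain K where K: "\<And>x. nrm (S x) \<le> K * nrm x" using assms by (auto simp: bop_def)
  let ?A = "insert 0 {nrm (S x) | x. nrm x \<le> 1}"
  \<comment> \<open>The constant in \<open>bop\<close> comes without a sign, so its absolute value
    is used for the monotonicity steps.\<close>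
  have "nrm (S x) \<le> \<bar>K\<bar>" if "nrm x \<le> 1" for x
  proof -
    have "nrm (S x) \<le> \<bar>K\<bar> * nrm x"
      by (rule order_trans[OF K]) (simp add: mult_right_mono)
    also have "\<dots> \<le> \<bar>K\<bar> * 1" using that by (intro mult_left_mono) auto
    finally show ?thesis by simp
  qed
  then have bdd: "bdd_above ?A" by (intro bdd_aboveI[of _ "\<bar>K\<bar>"]) auto
  show "0 \<le> opnorm ip S" unfolding opnorm_def using bdd by (intro cSup_upper) auto
  show "nrm (S x) \<le> opnorm ip S * nrm x"
  proof (cases "x = 0")
    case True then show ?thesis using assms by (simp add: bounded_op_zero)
  next
    case False
    then have nx: "nrm x > 0" using nrm_nonneg[of x] by (metis nrm_eq_0 order_le_less)
    let ?u = "sc (complex_of_real (1 / nrm x)) x"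
    have "nrm ?u = 1" using nx False by (simp add: nrm_scale norm_divide)
    then have "nrm (S ?u) \<le> opnorm ip S"
      unfolding opnorm_def using bdd by (intro cSup_upper) auto
    moreover have "nrm (S ?u) = nrm (S x) / nrm x"
      using nx False assms by (simp add: bounded_op_scale nrm_scale norm_divide)
    ultimately show ?thesis using nx by (simp add: pos_divide_le_eq)
  qed
qed

lemma opnorm_le:
  assumes "c \<ge> 0" "\<And>x. nrm (S x) \<le> c * nrm x"
  shows "opnorm ip S \<le> c"
  unfolding opnorm_def
proof (rule cSup_least)
  fix r assume "r \<in> insert 0 {nrm (S x) | x. nrm x \<le> 1}"
  then consider "r = 0" | x where "r = nrm (S x)" "nrm x \<le> 1" by auto
  then show "r \<le> c"
  proof cases
    case 2
    then show ?thesis using assms(2)[of x] mult_left_mono[of "nrm x" 1 c] assms(1) by simp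
  qed (simp add: assms)
qed simp

lemma bounded_op_ident: "bounded_op (\<lambda>x. x)"
  by (rule bounded_opI[of _ 1]) auto

lemma bounded_op_scaled: assumes "bounded_op S" shows "bounded_op (\<lambda>x. sc a (S x))"
proof (rule bounded_opI)
  show "nrm (sc a (S x)) \<le> (cmod a * opnorm ip S) * nrm x" for x
    using opnorm_nonneg_bound[OF assms] by (simp add: nrm_scale mult_left_mono mult.assoc)
qed (use assms in \<open>auto simp: bounded_op_add bounded_op_scale algebra_simps\<close>)

lemma bounded_op_plus:
  assumes "bounded_op S" "bounded_op R" shows "bounded_op (\<lambda>x. S x + R x)"
proof (rule bounded_opI)
  show "nrm (S x + R x) \<le> (opnorm ip S + opnorm ip R) * nrm x" for x
    using opnorm_nonneg_bound(2)[OF assms(1), of x] opnorm_nonneg_bound(2)[OF assms(2), of x]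
      nrm_triangle[of "S x" "R x"] by (simp add: algebra_simps)
qed (use assms in \<open>auto simp: bounded_op_add bounded_op_scale algebra_simps\<close>)

lemma bounded_op_sub:
  assumes "bounded_op S" "bounded_op R" shows "bounded_op (\<lambda>x. S x - R x)"
  using bounded_op_plus[OF assms(1) bounded_op_scaled[OF assms(2), of "-1"]] by simp

lemma bounded_op_comp:
  assumes "bounded_op S" "bounded_op R" shows "bounded_op (S \<circ> R)"
proof (rule bounded_opI)
  show "nrm ((S \<circ> R) x) \<le> (opnorm ip S * opnorm ip R) * nrm x" for x
    using opnorm_nonneg_bound(2)[OF assms(1), of "R x"]
      mult_left_mono[OF opnorm_nonneg_bound(2)[OF assms(2), of x] opnorm_nonneg_bound(1)[OF assms(1)]]
    by (simp add: mult.assoc)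
qed (use assms in \<open>auto simp: bounded_op_add bounded_op_scale\<close>)

subsection \<open>Riesz representation and adjoints\<close>

text \<open>The representing vector minimises \<open>\<parallel>z\<parallel>\<^sup>2 - 2 Re (\<phi> z)\<close>; by the parallelogram
  law every minimising sequence is Cauchy.\<close>

lemma riesz:
  assumes add: "\<And>x y. \<phi> (x + y) = \<phi> x + \<phi> y" and scale: "\<And>a x. \<phi> (sc a x) = a * \<phi> x"
    and bnd: "\<And>x. cmod (\<phi> x) \<le> C * nrm x"
  obtains z where "\<And>x. \<phi> x = ip x z"
proof -
  define J where "J z = (nrm z)\<^sup>2 - 2 * Re (\<phi> z)" for z
  define m where "m = (INF z. J z)"
  have Jlow: "- C\<^sup>2 \<le> J z" for z
  proof -
    have "Re (\<phi> z) \<le> C * nrm z" using bnd[of z] complex_Re_le_cmod order_trans by blast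
    moreover have "0 \<le> (nrm z - C)\<^sup>2" by simp
    ultimately show ?thesis by (simp add: J_def power2_diff algebra_simps)
  qed
  then have bdd: "bdd_below (range J)" by (intro bdd_belowI[of _ "- C\<^sup>2"]) auto
  have mle: "m \<le> J z" for z unfolding m_def using bdd by (intro cINF_lower) auto
  have "\<exists>z. J z < m + 1 / Suc k" for k :: nat
    using cINF_less_iff[of UNIV J "m + 1 / Suc k"] bdd by (auto simp: m_def)
  then obtain X where X: "\<And>k. J (X k) < m + 1 / Suc k" by metis
  \<comment> \<open>The parallelogram law for \<open>a\<close> and \<open>b\<close>: the linear
    parts of \<open>J\<close> cancel, because \<open>\<phi>\<close> at the midpoint is the mean of
    its values.\<close>
  have par: "(nrm (a - b))\<^sup>2 = 2 * J a + 2 * J b - 4 * J (sc (1/2) (a + b))" for a b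
  proof -
    have "(nrm (sc (1/2) (a + b)))\<^sup>2 = (nrm (a + b))\<^sup>2 / 4"
      by (simp add: nrm_scale power_divide)
    moreover have "(nrm (a - b))\<^sup>2 = (nrm a)\<^sup>2 - 2 * Re (ip a b) + (nrm b)\<^sup>2"
      using nrm_add_sq[of a "- b"] by (simp add: ip_minus_right nrm_minus)
    moreover have "Re (\<phi> (sc (1/2) (a + b))) = (Re (\<phi> a) + Re (\<phi> b)) / 2"
      by (simp add: scale add)
    ultimately show ?thesis by (simp add: J_def nrm_add_sq[of a b] algebra_simps)
  qed
  have cau: "\<exists>N. \<forall>i\<ge>N. \<forall>k\<ge>N. nrm (X i - X k) < e" if "e > 0" for e
  proof -
    \<comment> \<open>Two values of \<open>J\<close> within \<open>1/N\<close> of the infimum, with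
      a midpoint value of at least \<open>m\<close>, leave \<open>4/N\<close> in
      \<open>par\<close>.\<close>
    obtain N :: nat where N: "4 / e\<^sup>2 < real N" using reals_Archimedean2 by blast
    have "nrm (X i - X k) < e" if "i \<ge> N" "k \<ge> N" for i k
    proof -
      have Np: "real N > 0" using N \<open>e > 0\<close> by (smt (verit) zero_less_divide_iff zero_less_power)
      have "1 / Suc i < 1 / real N" "1 / Suc k < 1 / real N" using that Np by (auto simp: field_simps)
      then have "J (X i) < m + 1 / real N" "J (X k) < m + 1 / real N"
        using X[of i] X[of k] by linarith+
      then have "(nrm (X i - X k))\<^sup>2 < 4 / real N"
        using mle[of "sc (1/2) (X i + X k)"] unfolding par by (simp add: field_simps)
      also have "\<dots> < e\<^sup>2" using N Np \<open>e > 0\<close> by (simp add: field_simps)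
      finally show ?thesis using \<open>e > 0\<close> by (simp add: power_less_imp_less_base)
    qed
    then show ?thesis by blast
  qed
  obtain z where z: "(\<lambda>k. nrm (X k - z)) \<longlonglongrightarrow> 0" using complete[OF cau] by blast
  have Jz: "J z = m"
  proof (rule antisym)
    have nz: "(\<lambda>k. nrm (X k)) \<longlonglongrightarrow> nrm z"
    proof (rule LIM_zero_cancel, rule tendsto_rabs_zero_cancel, rule tendsto_sandwich[OF _ _ tendsto_const z])
      show "\<forall>\<^sub>F n in sequentially. \<bar>nrm (X n) - nrm z\<bar> \<le> nrm (X n - z)"
        using nrm_triangle_rev by simp
    qed simp
    have pz: "(\<lambda>k. \<phi> (X k)) \<longlonglongrightarrow> \<phi> z"
    proof (rule LIM_zero_cancel, rule tendsto_norm_zero_cancel, rule tendsto_sandwich[OF _ _ tendsto_const])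
      show "(\<lambda>k. C * nrm (X k - z)) \<longlonglongrightarrow> 0" using tendsto_mult_left[OF z, of C] by simp
      have "\<phi> (X k) - \<phi> z = \<phi> (X k - z)" for k using add[of "X k - z" z] by simp
      then show "\<forall>\<^sub>F n in sequentially. cmod (\<phi> (X n) - \<phi> z) \<le> C * nrm (X n - z)"
        using bnd by simp
    qed simp
    have "(\<lambda>k. J (X k)) \<longlonglongrightarrow> J z" unfolding J_def by (intro tendsto_intros nz pz)
    moreover have "(\<lambda>k. m + 1 / Suc k) \<longlonglongrightarrow> m + 0"
      by (intro tendsto_intros LIMSEQ_Suc[OF lim_1_over_n])
    ultimately show "J z \<le> m" using X by (force intro: LIMSEQ_le less_imp_le)
  qed (rule mle)
  have re: "Re (\<phi> w) = Re (ip w z)" for w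
  proof -
    define d where "d = Re (ip w z) - Re (\<phi> w)"
    \<comment> \<open>Moving from the minimiser \<open>z\<close> by \<open>t\<close> along
      \<open>w\<close> changes \<open>J\<close> by this quadratic in \<open>t\<close>, so its linear
      coefficient has to vanish.\<close>
    have q: "0 \<le> 2 * t * d + t\<^sup>2 * (nrm w)\<^sup>2" for t :: real
    proof -
      have "J z \<le> J (z + sc (complex_of_real t) w)" using mle Jz by simp
      also have "\<dots> = J z + 2 * t * d + t\<^sup>2 * (nrm w)\<^sup>2"
        unfolding J_def nrm_add_sq ip_scale_right d_def
        using ip_commute[of z w]
        by (simp add: add scale nrm_scale power_mult_distrib algebra_simps)
      finally show ?thesis by simp
    qed
    have "d = 0"
    proof (rule ccontr)
      assume "d \<noteq> 0"
      \<comment> \<open>At \<open>t = - d / s\<close> the linear term outweighs the quadratic one;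
        the added 1 keeps \<open>s\<close> positive for \<open>w = 0\<close>.\<close>
      define s where "s = (nrm w)\<^sup>2 + 1"
      have s: "s > 0" "(nrm w)\<^sup>2 < s" unfolding s_def by (auto simp: add_nonneg_pos)
      have "2 * (- d / s) * d + (- d / s)\<^sup>2 * (nrm w)\<^sup>2 \<le> 2 * (- d / s) * d + (- d / s)\<^sup>2 * s"
        using s by (intro add_left_mono mult_left_mono) auto
      also have "\<dots> = - d\<^sup>2 / s" using s by (simp add: field_simps power2_eq_square)
      also have "\<dots> < 0" using s \<open>d \<noteq> 0\<close> by simp
      finally show False using q[of "- d / s"] by simp
    qed
    then show ?thesis by (simp add: d_def)
  qed
  \<comment> \<open>Applying the equality of real parts to \<open>sc \<i> w\<close> yields the
    imaginary parts.\<close>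
  have "\<phi> w = ip w z" for w
    using re[of w] re[of "sc \<i> w"] by (simp add: complex_eq_iff scale ip_scale_left)
  then show thesis by (rule that)
qed

lemma adj_eqI:
  assumes "\<And>x. ip (S x) y = ip x z"
  shows "adj ip S y = z"
  unfolding adj_def using assms ip_cancel_right by (intro the_equality) metis+

text \<open>For fixed \<open>y\<close> the functional sending \<open>x\<close> to
  \<open>ip (S x) y\<close> is bounded by Cauchy-Schwarz, and Riesz supplies the vector that
  \<open>adj\<close> describes.\<close>

lemma adj_works:
  assumes "bounded_op S"
  shows "ip (S x) y = ip x (adj ip S y)"
proof -
  have "cmod (ip (S w) y) \<le> (opnorm ip S * nrm y) * nrm w" for w
    using cauchy_schwarz[of "S w" y]
      mult_right_mono[OF opnorm_nonneg_bound(2)[OF assms, of w] nrm_nonneg[of y]]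
    by (simp add: mult_ac)
  then obtain z where z: "\<And>x. ip (S x) y = ip x z"
    using riesz[of "\<lambda>x. ip (S x) y"] assms
    by (metis bounded_op_add bounded_op_scale ip_add_left ip_scale_left)
  then show ?thesis using adj_eqI by metis
qed

lemma adj_works':
  assumes "bounded_op S"
  shows "ip (adj ip S x) y = ip x (S y)"
  by (metis adj_works[OF assms] ip_commute)

lemma bounded_op_adj:
  assumes "bounded_op S"
  shows "bounded_op (adj ip S)"
proof (rule bounded_opI)
  show "nrm (adj ip S y) \<le> opnorm ip S * nrm y" for y
  proof -
    let ?z = "adj ip S y"
    have "(nrm ?z)\<^sup>2 = Re (ip (S ?z) y)" by (simp add: nrm_sq adj_works[OF assms])
    also have "\<dots> \<le> nrm (S ?z) * nrm y"
      using cauchy_schwarz complex_Re_le_cmod order_trans by blast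
    also have "\<dots> \<le> (opnorm ip S * nrm ?z) * nrm y"
      by (intro mult_right_mono opnorm_nonneg_bound assms) simp
    finally have "nrm ?z * nrm ?z \<le> (opnorm ip S * nrm y) * nrm ?z"
      by (simp add: power2_eq_square mult_ac)
    then show ?thesis
      using opnorm_nonneg_bound(1)[OF assms] nrm_nonneg[of ?z]
      by (cases "nrm ?z = 0") (auto simp: mult_le_cancel_right)
  qed
qed (auto intro!: adj_eqI simp: adj_works[OF assms] ip_add_right ip_scale_right)

lemma adj_adj:
  assumes "bounded_op S"
  shows "adj ip (adj ip S) = S"
  by (rule ext, rule adj_eqI) (simp add: adj_works'[OF assms])

subsection \<open>Polynomials of an operator\<close>

text \<open>The counterpart of \<open>peval\<close> with complex coefficients, since the linear
  factors of a real polynomial may have non-real roots.\<close>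

definition cpeval :: "complex poly \<Rightarrow> ('a \<Rightarrow> 'a) \<Rightarrow> 'a \<Rightarrow> 'a" where
  "cpeval q P x = (\<Sum>i\<le>degree q. sc (coeff q i) ((P ^^ i) x))"

text \<open>Padding with zero coefficients lets polynomials of different degrees be summed over a
  common range.\<close>

lemma cpeval_upto:
  assumes "degree q \<le> N"
  shows "cpeval q P x = (\<Sum>i\<le>N. sc (coeff q i) ((P ^^ i) x))"
  unfolding cpeval_def
  by (rule sum.mono_neutral_left) (use assms in \<open>auto simp: coeff_eq_0\<close>)

lemma cpeval_0 [simp]: "cpeval 0 P x = 0"
  by (simp add: cpeval_def)

lemma cpeval_add: "cpeval (p + q) P x = cpeval p P x + cpeval q P x"
proof -
  let ?N = "max (degree p) (degree q)"
  show ?thesis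
    using cpeval_upto[of "p + q" ?N] cpeval_upto[of p ?N] cpeval_upto[of q ?N] degree_add_le_max[of p q]
    by (simp add: scale_left_distrib sum.distrib)
qed

lemma cpeval_smult: "cpeval (smult a p) P x = sc a (cpeval p P x)"
  using cpeval_upto[of "smult a p" "degree p"]
  by (simp add: cpeval_def degree_smult_le scale_sum_right)

lemma bounded_op_sum: "bounded_op P \<Longrightarrow> P (sum h A) = (\<Sum>i\<in>A. P (h i))"
  by (induction A rule: infinite_finite_induct) (auto simp: bounded_op_add bounded_op_zero)

lemma cpeval_pCons:
  assumes "bounded_op P"
  shows "cpeval (pCons a p) P x = sc a x + P (cpeval p P x)"
proof -
  have "cpeval (pCons a p) P x = (\<Sum>i\<le>Suc (degree p). sc (coeff (pCons a p) i) ((P ^^ i) x))"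
    by (rule cpeval_upto) (simp add: degree_pCons_le)
  also have "\<dots> = sc a x + (\<Sum>i\<le>degree p. sc (coeff p i) (P ((P ^^ i) x)))"
    by (subst sum.atMost_Suc_shift) simp
  also have "\<dots> = sc a x + P (cpeval p P x)"
    unfolding cpeval_def by (simp only: bounded_op_sum[OF assms] bounded_op_scale[OF assms])
  finally show ?thesis .
qed

lemma peval_eq_cpeval: "peval sc q P x = cpeval (map_poly complex_of_real q) P x"
  by (simp add: peval_def cpeval_def degree_map_poly coeff_map_poly)

lemma peval_0 [simp]: "peval sc 0 P x = 0"
  by (simp add: peval_eq_cpeval)

lemma peval_add: "peval sc (p + q) P x = peval sc p P x + peval sc q P x"
proof -
  have "map_poly complex_of_real (p + q) = map_poly complex_of_real p + map_poly complex_of_real q"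
    by (rule poly_eqI) (simp add: coeff_map_poly)
  then show ?thesis by (simp add: peval_eq_cpeval cpeval_add)
qed

lemma peval_smult: "peval sc (smult a p) P x = sc (complex_of_real a) (peval sc p P x)"
  by (simp add: peval_eq_cpeval map_poly_smult cpeval_smult)

lemma peval_diff: "peval sc (p - q) P x = peval sc p P x - peval sc q P x"
  using peval_add[of p "- q"] peval_smult[of "-1" q] by simp

lemma peval_pCons:
  "bounded_op P \<Longrightarrow> peval sc (pCons a p) P x = sc (complex_of_real a) x + P (peval sc p P x)"
  by (simp add: peval_eq_cpeval map_poly_pCons cpeval_pCons)

lemma bounded_op_peval: "bounded_op P \<Longrightarrow> bounded_op (peval sc p P)"
proof (induction p)
  case 0
  show ?case by (rule bounded_opI[of _ 0]) simp_all
next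
  case (pCons a p)
  have "peval sc (pCons a p) P = (\<lambda>x. sc (complex_of_real a) x + (P \<circ> peval sc p P) x)"
    using pCons.prems by (simp add: fun_eq_iff peval_pCons)
  then show ?case
    using bounded_op_plus[OF bounded_op_scaled[OF bounded_op_ident] bounded_op_comp[OF pCons.prems]]
      pCons by simp
qed

text \<open>With \<open>P\<close>, \<open>Q\<close> and \<open>S\<close> all equal this says that
  \<open>P\<close> commutes with its polynomials; with different \<open>P\<close> and
  \<open>Q\<close> it later carries functions of \<open>|S|\<close> to functions of the absolute
  value of the adjoint.\<close>

lemma peval_intertwine:
  assumes "bounded_op P" "bounded_op Q" "bounded_op S" "\<And>x. S (P x) = Q (S x)"
  shows "S (peval sc p P x) = peval sc p Q (S x)"
  by (induction p)
    (simp_all add: assms(1-3) peval_pCons bounded_op_zero bounded_op_add bounded_op_scale assms(4))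

lemma peval_mult:
  assumes "bounded_op P"
  shows "peval sc (p * q) P x = peval sc p P (peval sc q P x)"
proof (induction p)
  case (pCons a p)
  then show ?case by (simp add: assms peval_add peval_smult peval_pCons)
qed simp

text \<open>Symmetry is a separate clause because a nonnegative real part of the quadratic form does
  not imply it: multiplication by \<open>\<i>\<close> has real part zero.\<close>

definition pos_op :: "('a \<Rightarrow> 'a) \<Rightarrow> bool" where
  "pos_op P \<longleftrightarrow> bounded_op P \<and> (\<forall>x y. ip (P x) y = ip x (P y)) \<and> (\<forall>x. 0 \<le> Re (ip (P x) x))"

lemma pos_op_bounded: "pos_op P \<Longrightarrow> bounded_op P"
  and pos_op_selfadj: "pos_op P \<Longrightarrow> ip (P x) y = ip x (P y)"
  and pos_op_nonneg: "pos_op P \<Longrightarrow> 0 \<le> Re (ip (P x) x)"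
  unfolding pos_op_def by blast+

lemma pos_op_Im: "pos_op P \<Longrightarrow> Im (ip (P x) x) = 0"
  using ip_commute[of x "P x"] pos_op_selfadj[of P x x]
  by (metis complex_cnj_cancel_iff cnj.simps(2) equal_neg_zero)

lemma peval_selfadj:
  assumes "pos_op P"
  shows "ip (peval sc p P x) y = ip x (peval sc p P y)"
proof (induction p arbitrary: x y)
  case (pCons a p)
  have "P (peval sc p P y) = peval sc p P (P y)"
    using peval_intertwine[of P P P] assms by (simp add: pos_op_bounded)
  then show ?case
    using pCons by (simp add: pos_op_bounded[OF assms] peval_pCons ip_add_left ip_add_right
        ip_scale_left ip_scale_right pos_op_selfadj[OF assms])
qed simp

subsection \<open>The spectral bound\<close>

text \<open>Being bounded below, \<open>c \<parallel>x\<parallel> \<le> \<parallel>S x\<parallel>\<close> with \<open>c > 0\<close>, replaces invertibility for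
  polynomials in a positive operator, so no spectrum is needed.\<close>

lemma pos_op_shift_bounded_below:
  assumes P: "pos_op P" and mu: "\<And>t. 0 \<le> t \<Longrightarrow> t \<le> opnorm ip P \<Longrightarrow> \<mu> \<noteq> complex_of_real t"
  obtains c where "c > 0" "\<And>x. c * nrm x \<le> nrm (P x - sc \<mu> x)"
proof -
  note witness = that
  \<comment> \<open>A lower bound for the quadratic form suffices: by Cauchy-Schwarz one factor
    \<open>nrm x\<close> can be cancelled.\<close>
  have key: thesis if "d > 0" and d: "\<And>x. d * (nrm x)\<^sup>2 \<le> cmod (ip (P x - sc \<mu> x) x)" for d
  proof (rule witness[OF \<open>d > 0\<close>])
    fix x
    have "d * nrm x * nrm x \<le> nrm (P x - sc \<mu> x) * nrm x"
      using order_trans[OF d cauchy_schwarz] by (simp add: power2_eq_square mult.assoc)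
    then show "d * nrm x \<le> nrm (P x - sc \<mu> x)"
      using nrm_nonneg[of x] by (cases "nrm x = 0") (auto simp: mult_le_cancel_right)
  qed
  have Re: "Re (ip (P x - sc \<mu> x) x) = Re (ip (P x) x) - Re \<mu> * (nrm x)\<^sup>2"
    and Im: "Im (ip (P x - sc \<mu> x) x) = - Im \<mu> * (nrm x)\<^sup>2" for x
    using pos_op_Im[OF P, of x] by (simp_all add: ip_diff_left ip_scale_left ip_self)
  have up: "Re (ip (P x) x) \<le> opnorm ip P * (nrm x)\<^sup>2" for x
  proof -
    have "Re (ip (P x) x) \<le> nrm (P x) * nrm x"
      using cauchy_schwarz complex_Re_le_cmod order_trans by blast
    also have "\<dots> \<le> opnorm ip P * nrm x * nrm x"
      by (intro mult_right_mono opnorm_nonneg_bound pos_op_bounded P) simp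
    finally show ?thesis by (simp add: power2_eq_square mult.assoc)
  qed
  \<comment> \<open>The ways to miss the segment from 0 to \<open>opnorm ip P\<close>: off the real
    axis, to its left, to its right. Each gap serves as the lower bound.\<close>
  consider "Im \<mu> \<noteq> 0" | "Im \<mu> = 0" "Re \<mu> < 0" | "Im \<mu> = 0" "Re \<mu> > opnorm ip P"
    using mu[of "Re \<mu>"] by (force simp: complex_eq_iff)
  then show thesis
  proof cases
    case 1
    show ?thesis
    proof (rule key[of "\<bar>Im \<mu>\<bar>"])
      fix x
      have "\<bar>Im \<mu>\<bar> * (nrm x)\<^sup>2 = \<bar>Im (ip (P x - sc \<mu> x) x)\<bar>" by (simp add: Im abs_mult)
      also have "\<dots> \<le> cmod (ip (P x - sc \<mu> x) x)" by (rule abs_Im_le_cmod)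
      finally show "\<bar>Im \<mu>\<bar> * (nrm x)\<^sup>2 \<le> cmod (ip (P x - sc \<mu> x) x)" .
    qed (use 1 in simp)
  next
    case 2
    show ?thesis
    proof (rule key[of "- Re \<mu>"])
      fix x
      have "- Re \<mu> * (nrm x)\<^sup>2 \<le> Re (ip (P x - sc \<mu> x) x)" using pos_op_nonneg[OF P, of x] by (simp add: Re)
      also have "\<dots> \<le> cmod (ip (P x - sc \<mu> x) x)" by (rule complex_Re_le_cmod)
      finally show "- Re \<mu> * (nrm x)\<^sup>2 \<le> cmod (ip (P x - sc \<mu> x) x)" .
    qed (use 2 in simp)
  next
    case 3
    show ?thesis
    proof (rule key[of "Re \<mu> - opnorm ip P"])
      fix x
      have "(Re \<mu> - opnorm ip P) * (nrm x)\<^sup>2 \<le> - Re (ip (P x - sc \<mu> x) x)"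
        using up[of x] by (simp add: Re left_diff_distrib)
      also have "\<dots> \<le> cmod (ip (P x - sc \<mu> x) x)"
        using abs_Re_le_cmod[of "ip (P x - sc \<mu> x) x"] by linarith
      finally show "(Re \<mu> - opnorm ip P) * (nrm x)\<^sup>2 \<le> cmod (ip (P x - sc \<mu> x) x)" .
    qed (use 3 in simp)
  qed
qed

text \<open>A root of \<open>r\<close> lies off the segment, so its linear factor is bounded below;
  lower bounds of composed operators multiply, and induction on the degree finishes.\<close>

lemma cpeval_bounded_below:
  assumes P: "pos_op P"
    and "\<And>t. 0 \<le> t \<Longrightarrow> t \<le> opnorm ip P \<Longrightarrow> poly r (complex_of_real t) \<noteq> 0"
  shows "\<exists>c>0. \<forall>x. c * nrm x \<le> nrm (cpeval r P x)"
  using assms(2)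
proof (induction "degree r" arbitrary: r)
  case 0
  then obtain a where r: "r = [:a:]" by (metis degree_eq_zeroE)
  have "a \<noteq> 0" using 0(2)[of 0] opnorm_nonneg_bound(1)[OF pos_op_bounded[OF P]] r by simp
  then show ?case
    by (intro exI[of _ "cmod a"]) (simp add: r cpeval_def nrm_scale)
next
  case (Suc k)
  then have "\<not> constant (poly r)" by (simp add: constant_degree)
  then obtain \<mu> where "poly r \<mu> = 0" using fundamental_theorem_of_algebra by blast
  then obtain s where r: "r = [:- \<mu>, 1:] * s" by (auto simp: poly_eq_0_iff_dvd dvd_def)
  then have "s \<noteq> 0" using Suc.hyps(2) by auto
  then have deg: "k = degree s" using Suc.hyps(2) r by (simp add: degree_mult_eq del: mult_pCons_left)
  have "poly s (complex_of_real t) \<noteq> 0" if "0 \<le> t" "t \<le> opnorm ip P" for t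
    using Suc.prems[OF that] r by auto
  then obtain c where c: "c > 0" "\<And>x. c * nrm x \<le> nrm (cpeval s P x)"
    using Suc.hyps(1)[OF deg] by metis
  have "\<mu> \<noteq> complex_of_real t" if "0 \<le> t" "t \<le> opnorm ip P" for t
    using Suc.prems[OF that] r by auto
  then obtain d where d: "d > 0" "\<And>x. d * nrm x \<le> nrm (P x - sc \<mu> x)"
    using pos_op_shift_bounded_below[OF P] by metis
  have "cpeval r P x = P (cpeval s P x) - sc \<mu> (cpeval s P x)" for x
    using cpeval_add[of "pCons 0 s" "smult (- \<mu>) s"] cpeval_smult[of "- \<mu>" s]
    by (simp add: r cpeval_pCons pos_op_bounded[OF P])
  then have "d * c * nrm x \<le> nrm (cpeval r P x)" for x
    using order_trans[OF mult_left_mono[OF c(2)[of x]] d(2)[of "cpeval s P x"]] d(1)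
    by (simp add: mult.assoc)
  then show ?case using c(1) d(1) by (intro exI[of _ "d * c"]) simp
qed

lemma poly_map_poly_of_real: "poly (map_poly complex_of_real r) (complex_of_real t) = complex_of_real (poly r t)"
  by (induction r) (simp_all add: map_poly_pCons)

text \<open>If \<open>s = \<parallel>p(P)\<parallel>\<close> exceeded \<open>m\<close>, then \<open>s\<^sup>2 - p\<^sup>2\<close> would have no zero on \<open>[0, \<parallel>P\<parallel>]\<close>, so
  \<open>s\<^sup>2 - p(P)\<^sup>2\<close> would be bounded below, against the choice of \<open>s\<close>.\<close>

lemma peval_norm_le:
  assumes P: "pos_op P" and m: "\<And>t. 0 \<le> t \<Longrightarrow> t \<le> opnorm ip P \<Longrightarrow> \<bar>poly p t\<bar> \<le> m"
  shows "nrm (peval sc p P x) \<le> m * nrm x"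
proof -
  note bP = pos_op_bounded[OF P]
  let ?S = "peval sc p P"
  define s where "s = opnorm ip ?S"
  have bS: "bounded_op ?S" by (rule bounded_op_peval[OF bP])
  have m0: "0 \<le> m" using m[of 0] opnorm_nonneg_bound(1)[OF bP] by force
  have "s \<le> m"
  proof (rule ccontr)
    assume "\<not> s \<le> m"
    then have sm: "m < s" by simp
    then have s0: "s > 0" using m0 by simp
    define r where "r = [:s\<^sup>2:] - p * p"
    have "poly r t \<noteq> 0" if "0 \<le> t" "t \<le> opnorm ip P" for t
    proof -
      have "\<bar>poly p t\<bar> < \<bar>s\<bar>" using m[OF that] sm s0 by simp
      then have "(poly p t)\<^sup>2 < s\<^sup>2" by (meson abs_le_square_iff not_le)
      then show ?thesis by (simp add: r_def power2_eq_square)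
    qed
    then obtain c where c: "c > 0" "\<And>x. c * nrm x \<le> nrm (peval sc r P x)"
      using cpeval_bounded_below[OF P, of "map_poly complex_of_real r"]
      by (auto simp: poly_map_poly_of_real peval_eq_cpeval)
    have rx: "peval sc r P x = sc (complex_of_real (s\<^sup>2)) x - ?S (?S x)" for x
      by (simp add: r_def peval_diff peval_mult bP peval_pCons bounded_op_zero)
    \<comment> \<open>Expanding the square of \<open>s\<^sup>2 x - S\<^sup>2 x\<close>, the last
      term is at most \<open>s\<^sup>2\<close> times the square norm of \<open>S x\<close> and
      absorbs half of the cross term. Comparison with the lower bound \<open>c\<close> leaves the
      gain \<open>c\<^sup>2 / s\<^sup>2\<close>.\<close>
    have est: "(nrm (?S x))\<^sup>2 \<le> (s\<^sup>2 - c\<^sup>2 / s\<^sup>2) * (nrm x)\<^sup>2" for x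
    proof -
      have "ip (sc (complex_of_real (s\<^sup>2)) x) (?S (?S x)) = complex_of_real (s\<^sup>2) * ip (?S x) (?S x)"
        by (simp add: ip_scale_left peval_selfadj[OF P])
      then have "Re (ip (sc (complex_of_real (s\<^sup>2)) x) (?S (?S x))) = s\<^sup>2 * (nrm (?S x))\<^sup>2"
        by (simp add: ip_self)
      then have "(nrm (peval sc r P x))\<^sup>2
          = s ^ 4 * (nrm x)\<^sup>2 - 2 * (s\<^sup>2 * (nrm (?S x))\<^sup>2) + (nrm (?S (?S x)))\<^sup>2"
        using nrm_add_sq[of "sc (complex_of_real (s\<^sup>2)) x" "- ?S (?S x)"]
        by (simp add: rx ip_minus_right nrm_minus nrm_scale power_mult_distrib norm_power)
      also have "(nrm (?S (?S x)))\<^sup>2 \<le> (s * nrm (?S x))\<^sup>2"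
        using opnorm_nonneg_bound(2)[OF bS, of "?S x"] by (intro power_mono) (auto simp: s_def)
      finally have "(nrm (peval sc r P x))\<^sup>2 \<le> s ^ 4 * (nrm x)\<^sup>2 - s\<^sup>2 * (nrm (?S x))\<^sup>2"
        by (simp add: power_mult_distrib)
      moreover have "(c * nrm x)\<^sup>2 \<le> (nrm (peval sc r P x))\<^sup>2"
        using c by (intro power_mono) auto
      ultimately have "s\<^sup>2 * (nrm (?S x))\<^sup>2 \<le> (s ^ 4 - c\<^sup>2) * (nrm x)\<^sup>2"
        by (simp add: power_mult_distrib left_diff_distrib)
      also have "\<dots> = s\<^sup>2 * ((s\<^sup>2 - c\<^sup>2 / s\<^sup>2) * (nrm x)\<^sup>2)"
        using s0 by (simp add: field_simps power2_eq_square power4_eq_xxxx)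
      finally show ?thesis using s0 by simp
    qed
    define k where "k = s\<^sup>2 - c\<^sup>2 / s\<^sup>2"
    have "k < s\<^sup>2" using c s0 by (simp add: k_def)
    \<comment> \<open>The sign of \<open>k\<close> is not known, hence the maximum with 0 before the
      root is taken; both 0 and \<open>k\<close> are below \<open>s\<^sup>2\<close>.\<close>
    have "s \<le> sqrt (max 0 k)"
      unfolding s_def
    proof (rule opnorm_le)
      fix x
      have "(nrm (?S x))\<^sup>2 \<le> max 0 k * (nrm x)\<^sup>2"
        using est[of x] unfolding k_def[symmetric]
        by (rule order_trans) (simp add: mult_right_mono)
      then show "nrm (?S x) \<le> sqrt (max 0 k) * nrm x"
        using real_le_rsqrt by (fastforce simp: real_sqrt_mult)
    qed simp
    then have "s\<^sup>2 \<le> max 0 k"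
      using power_mono[of s "sqrt (max 0 k)" 2] s0 by simp
    then show False using \<open>k < s\<^sup>2\<close> zero_less_power[OF s0, of 2] by linarith
  qed
  then show ?thesis
    using opnorm_nonneg_bound(2)[OF bS, of x] mult_right_mono[of s m "nrm x"]
    by (simp add: s_def)
qed

subsection \<open>Continuous functional calculus\<close>

abbreviation fc :: "(real \<Rightarrow> real) \<Rightarrow> ('a \<Rightarrow> 'a) \<Rightarrow> 'a \<Rightarrow> 'a" where "fc \<equiv> fcalc sc ip"

text \<open>By the norm bound for polynomials, operators of uniformly close polynomials are close,
  so completeness gives a pointwise limit. The error estimate for an arbitrary polynomial, not just
  those of the chosen sequence, is what makes the limit independent of that sequence.\<close>

lemma fcalc_exists:
  assumes P: "pos_op P" and h: "continuous_on {0..opnorm ip P} h"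
  obtains L where "bounded_op L"
    "\<And>p e x. (\<And>t. 0 \<le> t \<Longrightarrow> t \<le> opnorm ip P \<Longrightarrow> \<bar>poly p t - h t\<bar> \<le> e)
      \<Longrightarrow> nrm (peval sc p P x - L x) \<le> e * nrm x"
proof -
  let ?M = "opnorm ip P"
  note bP = pos_op_bounded[OF P]
  define app where "app p e \<longleftrightarrow> (\<forall>t. 0 \<le> t \<longrightarrow> t \<le> ?M \<longrightarrow> \<bar>poly p t - h t\<bar> \<le> e)" for p e
  have "\<exists>p. app p (1 / Suc k)" for k
    using weierstrass_poly[OF h, of "1 / Suc k"] unfolding app_def
    by (metis of_nat_0_less_iff zero_less_Suc zero_less_divide_1_iff)
  then obtain p where p: "\<And>k. app (p k) (1 / Suc k)" by metis
  have diff: "nrm (peval sc q P x - peval sc r P x) \<le> (d + e) * nrm x"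
    if "app q d" "app r e" for q r d e x
  proof -
    have "\<bar>poly (q - r) t\<bar> \<le> d + e" if "0 \<le> t" "t \<le> ?M" for t
    proof -
      have "\<bar>poly q t - h t\<bar> \<le> d" "\<bar>poly r t - h t\<bar> \<le> e"
        using that \<open>app q d\<close> \<open>app r e\<close> by (auto simp: app_def)
      then show ?thesis unfolding poly_diff by linarith
    qed
    then show ?thesis using peval_norm_le[OF P, of "q - r" "d + e" x] by (simp add: peval_diff)
  qed
  have "\<exists>y. (\<lambda>k. nrm (peval sc (p k) P x - y)) \<longlonglongrightarrow> 0" for x
  proof (rule complete[of "\<lambda>k. peval sc (p k) P x"])
    fix e :: real assume "e > 0"
    obtain N :: nat where N: "2 * (nrm x + 1) / e < real N" using reals_Archimedean2 by blast
    have Np: "real N > 0" using N \<open>e > 0\<close> nrm_nonneg[of x]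
      by (smt (verit) divide_nonneg_pos)
    have "nrm (peval sc (p i) P x - peval sc (p k) P x) < e" if "i \<ge> N" "k \<ge> N" for i k
    proof -
      have "1 / Suc i \<le> 1 / real N" "1 / Suc k \<le> 1 / real N" using that Np by (auto simp: field_simps)
      then have "(1 / Suc i + 1 / Suc k) * nrm x \<le> (2 / real N) * nrm x"
        by (intro mult_right_mono) auto
      also have "\<dots> \<le> (2 / real N) * (nrm x + 1)" by (intro mult_left_mono) auto
      also have "\<dots> < e" using N Np \<open>e > 0\<close> by (simp add: field_simps)
      finally show ?thesis using diff[OF p[of i] p[of k], of x] by linarith
    qed
    then show "\<exists>N. \<forall>m\<ge>N. \<forall>k\<ge>N. nrm (peval sc (p m) P x - peval sc (p k) P x) < e" by blast
  qed blast
  then obtain L where L: "\<And>x. (\<lambda>k. nrm (peval sc (p k) P x - L x)) \<longlonglongrightarrow> 0" by metis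
  \<comment> \<open>Compare \<open>q\<close> with \<open>p k\<close>, whose own error
    \<open>1 / Suc k\<close> disappears in the limit.\<close>
  have approx: "nrm (peval sc q P x - L x) \<le> e * nrm x" if q: "app q e" for q e x
  proof (rule LIMSEQ_le_const)
    show "(\<lambda>k. (e + 1 / Suc k) * nrm x + nrm (peval sc (p k) P x - L x)) \<longlonglongrightarrow> e * nrm x"
      using tendsto_add[OF tendsto_mult_right[OF tendsto_add[OF tendsto_const[of e]
              LIMSEQ_Suc[OF lim_1_over_n]], of "nrm x"] L[of x]]
      by simp
    show "\<exists>N. \<forall>k\<ge>N. nrm (peval sc q P x - L x)
        \<le> (e + 1 / Suc k) * nrm x + nrm (peval sc (p k) P x - L x)"
    proof (intro exI allI impI)
      fix k
      show "nrm (peval sc q P x - L x)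
          \<le> (e + 1 / Suc k) * nrm x + nrm (peval sc (p k) P x - L x)"
        using nrm_triangle_mid[of "peval sc q P x" "L x" "peval sc (p k) P x"]
          diff[OF q p[of k], of x] by linarith
    qed
  qed
  have "\<exists>q. app q e" if "e > 0" for e
    using weierstrass_poly[OF h that] unfolding app_def by metis
  then obtain q where q: "\<And>e. e > 0 \<Longrightarrow> app (q e) e" by metis
  have apq: "nrm (peval sc (q e) P x - L x) \<le> e * nrm x" if "e > 0" for e x
    using approx[OF q[OF that]] .
  note bq = bounded_op_peval[OF bP]
  have "bounded_op L"
  proof (rule bounded_opI)
    show "L (x + y) = L x + L y" for x y
    proof (rule eq_if_nrm_le_eps)
      fix e :: real assume e: "0 < e"
      let ?S = "peval sc (q e) P"
      have eq: "L (x + y) - (L x + L y) = (L (x + y) - ?S (x + y)) + ((?S x - L x) + (?S y - L y))"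
        by (simp add: bounded_op_add[OF bq] algebra_simps)
      have "nrm (L (x + y) - (L x + L y))
          \<le> nrm (?S (x + y) - L (x + y)) + (nrm (?S x - L x) + nrm (?S y - L y))"
        using nrm_triangle[of "L (x + y) - ?S (x + y)" "(?S x - L x) + (?S y - L y)"]
          nrm_triangle[of "?S x - L x" "?S y - L y"] nrm_minus_commute[of "L (x + y)" "?S (x + y)"]
        unfolding eq by linarith
      then show "nrm (L (x + y) - (L x + L y)) \<le> e * (nrm (x + y) + nrm x + nrm y)"
        using apq[OF e, of "x + y"] apq[OF e, of x] apq[OF e, of y] unfolding distrib_left by linarith
    qed
    show "L (sc a x) = sc a (L x)" for a x
    proof (rule eq_if_nrm_le_eps)
      fix e :: real assume e: "0 < e"
      let ?S = "peval sc (q e) P"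
      have "L (sc a x) - sc a (L x) = (L (sc a x) - ?S (sc a x)) + sc a (?S x - L x)"
        by (simp add: bounded_op_scale[OF bq] algebra_simps)
      then have "nrm (L (sc a x) - sc a (L x)) \<le> nrm (?S (sc a x) - L (sc a x)) + cmod a * nrm (?S x - L x)"
        by (metis nrm_triangle nrm_minus_commute nrm_scale)
      then show "nrm (L (sc a x) - sc a (L x)) \<le> e * (nrm (sc a x) + cmod a * nrm x)"
        using apq[OF e, of "sc a x"] mult_left_mono[OF apq[OF e, of x], of "cmod a"]
        unfolding distrib_left by (simp add: mult_ac)
    qed
    show "nrm (L x) \<le> (opnorm ip (peval sc (q 1) P) + 1) * nrm x" for x
      using nrm_triangle_diff[of "peval sc (q 1) P x" "peval sc (q 1) P x - L x"] apq[of 1 x]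
        opnorm_nonneg_bound(2)[OF bq, of "q 1" x] by (simp add: distrib_right)
  qed
  then show thesis by (rule that) (simp add: approx app_def)
qed

lemma fcalc_works:
  assumes P: "pos_op P" and h: "continuous_on {0..opnorm ip P} h"
  shows bounded_op_fcalc: "bounded_op (fc h P)"
    and fcalc_approx: "(\<And>t. 0 \<le> t \<Longrightarrow> t \<le> opnorm ip P \<Longrightarrow> \<bar>poly p t - h t\<bar> \<le> e)
      \<Longrightarrow> nrm (peval sc p P x - fc h P x) \<le> e * nrm x"
proof -
  let ?I = "{0..opnorm ip P}"
  obtain L where L: "bounded_op L" and
    apx: "\<And>p e x. (\<And>t. 0 \<le> t \<Longrightarrow> t \<le> opnorm ip P \<Longrightarrow> \<bar>poly p t - h t\<bar> \<le> e)
      \<Longrightarrow> nrm (peval sc p P x - L x) \<le> e * nrm x"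
    using fcalc_exists[OF P h] by metis
  note bq = bounded_op_peval[OF pos_op_bounded[OF P]]
  define lim where "lim L \<longleftrightarrow> (\<forall>p :: nat \<Rightarrow> real poly.
        (\<forall>e>0. \<exists>N. \<forall>k\<ge>N. \<forall>t\<in>?I. \<bar>poly (p k) t - h t\<bar> < e)
        \<longrightarrow> (\<lambda>k. opnorm ip (\<lambda>x. peval sc (p k) P x - L x)) \<longlonglongrightarrow> 0)" for L
  have limL: "lim L"
    unfolding lim_def
  proof (intro allI impI)
    fix p :: "nat \<Rightarrow> real poly"
    assume p: "\<forall>e>0. \<exists>N. \<forall>k\<ge>N. \<forall>t\<in>?I. \<bar>poly (p k) t - h t\<bar> < e"
    show "(\<lambda>k. opnorm ip (\<lambda>x. peval sc (p k) P x - L x)) \<longlonglongrightarrow> 0"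
    proof (rule LIMSEQ_I)
      fix r :: real assume r: "r > 0"
      then obtain N where N: "\<And>k t. k \<ge> N \<Longrightarrow> t \<in> ?I \<Longrightarrow> \<bar>poly (p k) t - h t\<bar> < r / 2"
        using p half_gt_zero by metis
      have "norm (opnorm ip (\<lambda>x. peval sc (p k) P x - L x) - 0) < r" if "k \<ge> N" for k
      proof -
        have "opnorm ip (\<lambda>x. peval sc (p k) P x - L x) \<le> r / 2"
          using N[OF that] r by (intro opnorm_le apx less_imp_le) auto
        then show ?thesis using opnorm_nonneg_bound(1)[OF bounded_op_sub[OF bq L]] r by simp
      qed
      then show "\<exists>N. \<forall>k\<ge>N. norm (opnorm ip (\<lambda>x. peval sc (p k) P x - L x) - 0) < r" by blast
    qed
  qed
  \<comment> \<open>Weierstrass supplies an admissible sequence; without one the defining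
    implication would be vacuous and determine nothing.\<close>
  have uniq: "L' = L" if L': "bounded_op L'" "lim L'" for L'
  proof
    fix x
    have "\<exists>p. \<forall>t\<in>?I. \<bar>poly p t - h t\<bar> \<le> 1 / Suc k" for k
      using weierstrass_poly[OF h, of "1 / Suc k"]
      by (metis atLeastAtMost_iff of_nat_0_less_iff zero_less_Suc zero_less_divide_1_iff)
    then obtain p where p: "\<And>k t. t \<in> ?I \<Longrightarrow> \<bar>poly (p k) t - h t\<bar> \<le> 1 / Suc k" by metis
    have "\<exists>N. \<forall>k\<ge>N. \<forall>t\<in>?I. \<bar>poly (p k) t - h t\<bar> < e" if "e > 0" for e
    proof -
      obtain N where N: "1 / real (Suc N) < e" using \<open>e > 0\<close> nat_approx_posE by blast
      have "\<bar>poly (p k) t - h t\<bar> < e" if "k \<ge> N" "t \<in> ?I" for k t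
      proof -
        have "1 / real (Suc k) \<le> 1 / real (Suc N)" using that by (simp add: field_simps)
        then show ?thesis using p[OF that(2), of k] N by linarith
      qed
      then show ?thesis by blast
    qed
    then have "(\<lambda>k. opnorm ip (\<lambda>x. peval sc (p k) P x - L x)) \<longlonglongrightarrow> 0"
      "(\<lambda>k. opnorm ip (\<lambda>x. peval sc (p k) P x - L' x)) \<longlonglongrightarrow> 0"
      using \<open>lim L\<close> \<open>lim L'\<close> unfolding lim_def by blast+
    from tendsto_mult_right[OF tendsto_add[OF this], of "nrm x"]
    have "(\<lambda>k. (opnorm ip (\<lambda>x. peval sc (p k) P x - L x)
        + opnorm ip (\<lambda>x. peval sc (p k) P x - L' x)) * nrm x) \<longlonglongrightarrow> 0" by simp
    moreover have "nrm (L' x - L x) \<le> (opnorm ip (\<lambda>x. peval sc (p k) P x - L x)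
        + opnorm ip (\<lambda>x. peval sc (p k) P x - L' x)) * nrm x" for k
      using nrm_triangle_mid[of "L' x" "L x" "peval sc (p k) P x"]
        nrm_minus_commute[of "L' x" "peval sc (p k) P x"]
        opnorm_nonneg_bound(2)[OF bounded_op_sub[OF bq L], of "p k" x]
        opnorm_nonneg_bound(2)[OF bounded_op_sub[OF bq L'(1)], of "p k" x]
      by (simp add: distrib_right)
    ultimately have "nrm (L' x - L x) \<le> 0" by (intro LIMSEQ_le_const) auto
    then show "L' x = L x"
      using nrm_nonneg[of "L' x - L x"] by (metis order_antisym nrm_eq_0 right_minus_eq)
  qed
  have "fc h P = L"
    unfolding fcalc_def lim_def[symmetric]
  proof (rule the_equality)
    show "bounded_op L \<and> lim L" using L limL by blast
    show "L' = L" if "bounded_op L' \<and> lim L'" for L' using uniq that by blast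
  qed
  then show "bounded_op (fc h P)"
    "(\<And>t. 0 \<le> t \<Longrightarrow> t \<le> opnorm ip P \<Longrightarrow> \<bar>poly p t - h t\<bar> \<le> e)
      \<Longrightarrow> nrm (peval sc p P x - fc h P x) \<le> e * nrm x"
    using L apx by simp_all
qed

text \<open>To identify a value of the calculus it is enough to exhibit, for each small
  \<open>e\<close>, one polynomial that is near \<open>h\<close> and whose operator sends
  \<open>x\<close> near \<open>y\<close>. The constants may depend on \<open>x\<close>.\<close>

lemma fcalc_eqI:
  assumes P: "pos_op P" and h: "continuous_on {0..opnorm ip P} h"
    and ex: "\<And>e. 0 < e \<Longrightarrow> e \<le> 1 \<Longrightarrow> \<exists>p. (\<forall>t. 0 \<le> t \<longrightarrow> t \<le> opnorm ip P \<longrightarrow> \<bar>poly p t - h t\<bar> \<le> e * c)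
          \<and> nrm (peval sc p P x - y) \<le> e * d"
  shows "fc h P x = y"
proof (rule eq_if_nrm_le_eps)
  fix e :: real assume "0 < e" "e \<le> 1"
  then obtain p where p: "\<And>t. 0 \<le> t \<Longrightarrow> t \<le> opnorm ip P \<Longrightarrow> \<bar>poly p t - h t\<bar> \<le> e * c"
    "nrm (peval sc p P x - y) \<le> e * d" using ex by metis
  have "nrm (peval sc p P x - fc h P x) \<le> e * c * nrm x"
    using fcalc_approx[OF P h, of p "e * c"] p(1) by blast
  then show "nrm (fc h P x - y) \<le> e * (c * nrm x + d)"
    using p(2) nrm_triangle_mid[of "fc h P x" y "peval sc p P x"]
      nrm_minus_commute[of "fc h P x" "peval sc p P x"] by (simp add: distrib_left mult.assoc)
qed

text \<open>Only values on \<open>[0, norm P]\<close> enter the definition, so identities valid just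
  for nonnegative arguments may be used inside the calculus.\<close>

lemma fcalc_cong:
  assumes "\<And>t. 0 \<le> t \<Longrightarrow> t \<le> opnorm ip P \<Longrightarrow> h t = k t"
  shows "fc h P = fc k P"
proof -
  have "(\<forall>t\<in>{0..opnorm ip P}. \<bar>poly p t - h t\<bar> < e) = (\<forall>t\<in>{0..opnorm ip P}. \<bar>poly p t - k t\<bar> < e)"
    for p e using assms by (intro ball_cong) auto
  then show ?thesis unfolding fcalc_def by simp
qed

lemma fcalc_poly:
  assumes P: "pos_op P"
  shows "fc (poly p) P x = peval sc p P x"
  by (rule fcalc_eqI[OF P, where c = 0 and d = 0]) (auto intro!: exI[of _ p] continuous_intros)

lemma fcalc_ident:
  assumes P: "pos_op P"
  shows "fc (\<lambda>t. t) P x = P x"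
proof -
  have "fc (\<lambda>t. t) P = fc (poly [:0, 1:]) P" by (rule fcalc_cong) simp
  then show ?thesis
    using fcalc_poly[OF P, of "[:0, 1:]" x] pos_op_bounded[OF P] by (simp add: peval_pCons bounded_op_zero)
qed

lemma fcalc_one:
  assumes P: "pos_op P"
  shows "fc (\<lambda>t. 1) P x = x"
proof -
  have "fc (\<lambda>t. 1) P = fc (poly 1) P" by (rule fcalc_cong) simp
  then show ?thesis
    using fcalc_poly[OF P, of 1 x] pos_op_bounded[OF P] by (simp add: one_pCons peval_pCons bounded_op_zero)
qed

lemma fcalc_norm_le:
  assumes P: "pos_op P" and h: "continuous_on {0..opnorm ip P} h"
    and m: "\<And>t. 0 \<le> t \<Longrightarrow> t \<le> opnorm ip P \<Longrightarrow> \<bar>h t\<bar> \<le> m"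
  shows "nrm (fc h P x) \<le> m * nrm x"
proof (rule field_le_epsilon)
  fix e :: real assume "e > 0"
  \<comment> \<open>The error \<open>d * nrm x\<close> enters twice: in the bound on the polynomial
    and in its distance from \<open>h\<close>.\<close>
  define d where "d = e / (2 * (nrm x + 1))"
  have nx: "nrm x + 1 > 0" using nrm_nonneg[of x] by linarith
  have d: "d > 0" using \<open>e > 0\<close> nx by (simp add: d_def)
  obtain p where p: "\<And>t. 0 \<le> t \<Longrightarrow> t \<le> opnorm ip P \<Longrightarrow> \<bar>poly p t - h t\<bar> \<le> d"
    using weierstrass_poly[OF h d] by metis
  have "\<bar>poly p t\<bar> \<le> m + d" if "0 \<le> t" "t \<le> opnorm ip P" for t
    using p[OF that] m[OF that] by linarith
  from peval_norm_le[OF P this, of x]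
  have "nrm (peval sc p P x) \<le> (m + d) * nrm x" .
  moreover have "nrm (peval sc p P x - fc h P x) \<le> d * nrm x"
    using fcalc_approx[OF P h p] .
  ultimately have "nrm (fc h P x) \<le> m * nrm x + 2 * d * nrm x"
    using nrm_triangle_diff[of "peval sc p P x" "peval sc p P x - fc h P x"]
    by (simp add: distrib_right)
  also have "2 * d * nrm x \<le> 2 * d * (nrm x + 1)" using d by (intro mult_left_mono) auto
  also have "\<dots> = e" using nx unfolding d_def by (simp add: field_simps del: distrib_left_numeral)
  finally show "nrm (fc h P x) \<le> m * nrm x + e" by simp
qed

lemma fcalc_add:
  assumes P: "pos_op P"
    and h: "continuous_on {0..opnorm ip P} h" and k: "continuous_on {0..opnorm ip P} k"
  shows "fc (\<lambda>t. h t + k t) P x = fc h P x + fc k P x"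
proof (rule fcalc_eqI[OF P, where c = 2 and d = "2 * nrm x"])
  fix e :: real assume e: "0 < e"
  obtain p where p: "\<And>t. 0 \<le> t \<Longrightarrow> t \<le> opnorm ip P \<Longrightarrow> \<bar>poly p t - h t\<bar> \<le> e"
    using weierstrass_poly[OF h e] by metis
  obtain q where q: "\<And>t. 0 \<le> t \<Longrightarrow> t \<le> opnorm ip P \<Longrightarrow> \<bar>poly q t - k t\<bar> \<le> e"
    using weierstrass_poly[OF k e] by metis
  have "\<bar>poly (p + q) t - (h t + k t)\<bar> \<le> e * 2" if "0 \<le> t" "t \<le> opnorm ip P" for t
    unfolding poly_add using p[OF that] q[OF that] by linarith
  moreover have "nrm (peval sc (p + q) P x - (fc h P x + fc k P x)) \<le> e * (2 * nrm x)"
    using nrm_triangle[of "peval sc p P x - fc h P x" "peval sc q P x - fc k P x"]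
      fcalc_approx[OF P h p, of x] fcalc_approx[OF P k q, of x]
    by (simp add: peval_add algebra_simps)
  ultimately show "\<exists>p. (\<forall>t. 0 \<le> t \<longrightarrow> t \<le> opnorm ip P \<longrightarrow> \<bar>poly p t - (h t + k t)\<bar> \<le> e * 2) \<and>
      nrm (peval sc p P x - (fc h P x + fc k P x)) \<le> e * (2 * nrm x)" by blast
qed (intro continuous_intros h k)

lemma fcalc_mult:
  assumes P: "pos_op P"
    and h: "continuous_on {0..opnorm ip P} h" and k: "continuous_on {0..opnorm ip P} k"
  shows "fc (\<lambda>t. h t * k t) P x = fc h P (fc k P x)"
proof -
  obtain K where K: "\<And>t. 0 \<le> t \<Longrightarrow> t \<le> opnorm ip P \<Longrightarrow> \<bar>h t\<bar> \<le> K \<and> \<bar>k t\<bar> \<le> K"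
  proof -
    have "bounded (h ` {0..opnorm ip P} \<union> k ` {0..opnorm ip P})"
      by (intro bounded_Un[THEN iffD2] conjI compact_imp_bounded compact_continuous_image h k compact_Icc)
    then obtain K where "\<And>y. y \<in> h ` {0..opnorm ip P} \<union> k ` {0..opnorm ip P} \<Longrightarrow> \<bar>y\<bar> \<le> K"
      unfolding bounded_iff real_norm_def by blast
    then show thesis by (intro that[of K]) auto
  qed
  have K0: "0 \<le> K" using K[of 0] opnorm_nonneg_bound(1)[OF pos_op_bounded[OF P]] by force
  note bq = bounded_op_peval[OF pos_op_bounded[OF P]]
  show ?thesis
  proof (rule fcalc_eqI[OF P, where c = "2 * K + 1" and d = "(K + 1) * nrm x + nrm (fc k P x)"])
    fix e :: real assume e: "0 < e" "e \<le> 1"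
    obtain p where p: "\<And>t. 0 \<le> t \<Longrightarrow> t \<le> opnorm ip P \<Longrightarrow> \<bar>poly p t - h t\<bar> \<le> e"
      using weierstrass_poly[OF h e(1)] by metis
    obtain q where q: "\<And>t. 0 \<le> t \<Longrightarrow> t \<le> opnorm ip P \<Longrightarrow> \<bar>poly q t - k t\<bar> \<le> e"
      using weierstrass_poly[OF k e(1)] by metis
    \<comment> \<open>Here \<open>e \<le> 1\<close> is used, to bound the approximant independently
      of \<open>e\<close>.\<close>
    have pK: "\<bar>poly p t\<bar> \<le> K + 1" if "0 \<le> t" "t \<le> opnorm ip P" for t
      using p[OF that] K[OF that] e by linarith
    have "\<bar>poly (p * q) t - h t * k t\<bar> \<le> e * (2 * K + 1)" if t: "0 \<le> t" "t \<le> opnorm ip P" for t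
    proof -
      have "poly (p * q) t - h t * k t = poly p t * (poly q t - k t) + (poly p t - h t) * k t"
        by (simp add: algebra_simps)
      then have "\<bar>poly (p * q) t - h t * k t\<bar> \<le> \<bar>poly p t\<bar> * \<bar>poly q t - k t\<bar> + \<bar>poly p t - h t\<bar> * \<bar>k t\<bar>"
        by (metis abs_mult abs_triangle_ineq)
      also have "\<dots> \<le> (K + 1) * e + e * K"
        using pK[OF t] q[OF t] p[OF t] K[OF t] K0 e by (intro add_mono mult_mono) auto
      finally show ?thesis by (simp add: algebra_simps)
    qed
    moreover have "nrm (peval sc (p * q) P x - fc h P (fc k P x)) \<le> e * ((K + 1) * nrm x + nrm (fc k P x))"
    proof -
      let ?y = "fc k P x"
      \<comment> \<open>The operator form of the scalar splitting above: change the inner factor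
        first, then the outer one at the fixed vector \<open>?y\<close>.\<close>
      have "peval sc (p * q) P x - fc h P ?y
          = peval sc p P (peval sc q P x - ?y) + (peval sc p P ?y - fc h P ?y)"
        by (simp add: peval_mult[OF pos_op_bounded[OF P]] bounded_op_diff[OF bq])
      then have "nrm (peval sc (p * q) P x - fc h P ?y)
          \<le> nrm (peval sc p P (peval sc q P x - ?y)) + nrm (peval sc p P ?y - fc h P ?y)"
        using nrm_triangle by metis
      also have "\<dots> \<le> (K + 1) * (e * nrm x) + e * nrm ?y"
      proof (rule add_mono)
        have "nrm (peval sc p P (peval sc q P x - ?y)) \<le> (K + 1) * nrm (peval sc q P x - ?y)"
          by (rule peval_norm_le[OF P pK])
        also have "\<dots> \<le> (K + 1) * (e * nrm x)"
          using K0 by (intro mult_left_mono fcalc_approx[OF P k q]) auto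
        finally show "nrm (peval sc p P (peval sc q P x - ?y)) \<le> (K + 1) * (e * nrm x)" .
      qed (rule fcalc_approx[OF P h p])
      finally show ?thesis by (simp add: algebra_simps)
    qed
    ultimately show "\<exists>p. (\<forall>t. 0 \<le> t \<longrightarrow> t \<le> opnorm ip P \<longrightarrow> \<bar>poly p t - h t * k t\<bar> \<le> e * (2 * K + 1)) \<and>
        nrm (peval sc p P x - fc h P (fc k P x)) \<le> e * ((K + 1) * nrm x + nrm (fc k P x))" by blast
  qed (intro continuous_intros h k)
qed

lemma fcalc_selfadj:
  assumes P: "pos_op P" and h: "continuous_on {0..opnorm ip P} h"
  shows "ip (fc h P x) y = ip x (fc h P y)"
proof -
  have "cmod (ip (fc h P x) y - ip x (fc h P y)) \<le> 0 + e" if "e > 0" for e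
  proof -
    define d where "d = e / (2 * (nrm x * nrm y + 1))"
    have nx: "nrm x * nrm y + 1 > 0" by (simp add: add_nonneg_pos)
    have d: "d > 0" using \<open>e > 0\<close> nx by (simp add: d_def)
    obtain p where p: "\<And>t. 0 \<le> t \<Longrightarrow> t \<le> opnorm ip P \<Longrightarrow> \<bar>poly p t - h t\<bar> \<le> d"
      using weierstrass_poly[OF h d] by metis
    let ?u = "peval sc p P x - fc h P x" and ?v = "peval sc p P y - fc h P y"
    have "ip (fc h P x) y - ip x (fc h P y) = ip x ?v - ip ?u y"
      by (simp add: ip_diff_left ip_diff_right peval_selfadj[OF P])
    then have "cmod (ip (fc h P x) y - ip x (fc h P y)) \<le> nrm x * nrm ?v + nrm ?u * nrm y"
      using norm_triangle_ineq4[of "ip x ?v" "ip ?u y"] cauchy_schwarz[of x ?v] cauchy_schwarz[of ?u y]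
      by simp
    also have "\<dots> \<le> nrm x * (d * nrm y) + d * nrm x * nrm y"
      by (intro add_mono mult_left_mono mult_right_mono fcalc_approx[OF P h p]) auto
    also have "\<dots> \<le> 2 * d * (nrm x * nrm y + 1)" using d by (simp add: algebra_simps)
    also have "\<dots> = e" using nx unfolding d_def by (simp add: field_simps del: distrib_left_numeral)
    finally show ?thesis by simp
  qed
  from field_le_epsilon[OF this] show ?thesis by simp
qed

text \<open>A nonnegative \<open>h\<close> is the square of \<open>sqrt (h t)\<close>, so the
  quadratic form of \<open>h(P)\<close> is a square norm.\<close>

lemma pos_op_fcalc:
  assumes P: "pos_op P" and h: "continuous_on {0..opnorm ip P} h"
    and nn: "\<And>t. 0 \<le> t \<Longrightarrow> t \<le> opnorm ip P \<Longrightarrow> 0 \<le> h t"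
  shows "pos_op (fc h P)"
  unfolding pos_op_def
proof (intro conjI allI)
  fix x
  have r: "continuous_on {0..opnorm ip P} (\<lambda>t. sqrt (h t))" by (intro continuous_intros h)
  have "fc h P = fc (\<lambda>t. sqrt (h t) * sqrt (h t)) P" by (rule fcalc_cong) (simp add: nn)
  then have "fc h P x = fc (\<lambda>t. sqrt (h t)) P (fc (\<lambda>t. sqrt (h t)) P x)"
    by (simp only: fcalc_mult[OF P r r])
  then have "ip (fc h P x) x = ip (fc (\<lambda>t. sqrt (h t)) P x) (fc (\<lambda>t. sqrt (h t)) P x)"
    by (simp only: fcalc_selfadj[OF P r])
  then show "0 \<le> Re (ip (fc h P x) x)" by simp
qed (use bounded_op_fcalc[OF P h] fcalc_selfadj[OF P h] in auto)

lemma fcalc_intertwine: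
  assumes P: "pos_op P" and Q: "pos_op Q" and S: "bounded_op S" and SP: "\<And>x. S (P x) = Q (S x)"
    and h: "continuous_on {0..} h"
  shows "S (fc h P x) = fc h Q (S x)"
proof (rule eq_if_nrm_le_eps)
  fix e :: real assume e: "0 < e"
  \<comment> \<open>One polynomial has to serve both operators, so it approximates \<open>h\<close>
    on the longer of the two intervals.\<close>
  let ?M = "max (opnorm ip P) (opnorm ip Q)"
  have c: "continuous_on {0..a} h" for a by (rule continuous_on_subset[OF h]) auto
  obtain p where p: "\<And>t. 0 \<le> t \<Longrightarrow> t \<le> ?M \<Longrightarrow> \<bar>poly p t - h t\<bar> \<le> e"
    using weierstrass_poly[OF c e] by metis
  let ?u = "peval sc p P x - fc h P x" and ?v = "peval sc p Q (S x) - fc h Q (S x)"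
  have "S (fc h P x) - fc h Q (S x) = ?v - S ?u"
    by (simp add: bounded_op_diff[OF S] peval_intertwine[OF pos_op_bounded[OF P] pos_op_bounded[OF Q] S SP])
  then have "nrm (S (fc h P x) - fc h Q (S x)) \<le> nrm ?v + nrm (S ?u)"
    using nrm_triangle_diff by metis
  also have "\<dots> \<le> e * nrm (S x) + opnorm ip S * (e * nrm x)"
  proof (rule add_mono)
    show "nrm ?v \<le> e * nrm (S x)" by (rule fcalc_approx[OF Q c]) (simp add: p)
    have "nrm ?u \<le> e * nrm x" by (rule fcalc_approx[OF P c]) (simp add: p)
    then show "nrm (S ?u) \<le> opnorm ip S * (e * nrm x)"
      using opnorm_nonneg_bound[OF S] mult_left_mono order_trans by metis
  qed
  finally show "nrm (S (fc h P x) - fc h Q (S x)) \<le> e * (nrm (S x) + opnorm ip S * nrm x)"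
    by (simp add: algebra_simps)
qed

subsection \<open>Absolute value and the mixed Schwarz inequality\<close>

lemma pos_op_adj_comp:
  assumes "bounded_op S"
  shows "pos_op (adj ip S \<circ> S)"
  unfolding pos_op_def
proof (intro conjI allI)
  show "bounded_op (adj ip S \<circ> S)" by (intro bounded_op_comp bounded_op_adj assms)
qed (simp_all add: adj_works'[OF assms] adj_works[OF assms, symmetric])

lemma continuous_on_sqrt_fun: "continuous_on A sqrt"
  by (intro continuous_intros)

lemma pos_op_absop:
  assumes "bounded_op S"
  shows "pos_op (absop sc ip S)"
  unfolding absop_def
  by (rule pos_op_fcalc[OF pos_op_adj_comp[OF assms] continuous_on_sqrt_fun]) simp

lemma absop_sq:
  assumes "bounded_op S"
  shows "absop sc ip S (absop sc ip S x) = adj ip S (S x)"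
proof -
  let ?Q = "adj ip S \<circ> S"
  have Q: "pos_op ?Q" by (rule pos_op_adj_comp[OF assms])
  have "fc (\<lambda>t. sqrt t * sqrt t) ?Q = fc (\<lambda>t. t) ?Q" by (rule fcalc_cong) simp
  then have "fc sqrt ?Q (fc sqrt ?Q x) = fc (\<lambda>t. t) ?Q x"
    by (metis fcalc_mult[OF Q continuous_on_sqrt_fun continuous_on_sqrt_fun])
  then show ?thesis by (simp only: absop_def fcalc_ident[OF Q] comp_apply)
qed

text \<open>The part of the polar decomposition that is needed: under the norm, \<open>S\<close> can
  be exchanged for its absolute value.\<close>

lemma nrm_absop:
  assumes "bounded_op S"
  shows "nrm (absop sc ip S x) = nrm (S x)"
proof -
  let ?A = "absop sc ip S"
  have "ip (?A x) (?A x) = ip (?A (?A x)) x"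
    by (rule pos_op_selfadj[OF pos_op_absop[OF assms], symmetric])
  also have "\<dots> = ip (S x) (S x)" by (simp add: absop_sq[OF assms] adj_works'[OF assms])
  finally show ?thesis by (simp add: hnorm_def)
qed

text \<open>\<open>S\<close> intertwines \<open>S\<^sup>* S\<close> with \<open>S S\<^sup>*\<close>
  by associativity, hence also their square roots.\<close>

lemma absop_intertwine:
  assumes S: "bounded_op S"
  shows "S (absop sc ip S x) = absop sc ip (adj ip S) (S x)"
  unfolding absop_def adj_adj[OF S]
proof (rule fcalc_intertwine[OF pos_op_adj_comp[OF S] _ S _ continuous_on_sqrt_fun])
  show "pos_op (S \<circ> adj ip S)"
    using pos_op_adj_comp[OF bounded_op_adj[OF S]] by (simp only: adj_adj[OF S])
qed simp

text \<open>Instead of the polar decomposition, \<open>1\<close> is written as \<open>g(t) (t + \<epsilon>)\<^sup>-\<^sup>1 f(t)\<close> plus the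
  error \<open>\<epsilon>/(t + \<epsilon>)\<close>, which becomes at most \<open>\<epsilon>\<close> after composition with \<open>S\<close>; the contraction
  \<open>S (|S| + \<epsilon>)\<^sup>-\<^sup>1\<close> plays the role of the partial isometry.\<close>

lemma mixed_schwarz:
  assumes S: "bounded_op S"
    and f: "continuous_on {0..} f" and g: "continuous_on {0..} g"
    and fg: "\<And>t. t \<ge> 0 \<Longrightarrow> f t * g t = t"
  shows "cmod (ip (S x) y) \<le> nrm (fc f (absop sc ip S) x) * nrm (fc g (absop sc ip (adj ip S)) y)"
proof -
  let ?A = "absop sc ip S" and ?B = "absop sc ip (adj ip S)"
  have A: "pos_op ?A" and B: "pos_op ?B"
    by (intro pos_op_absop bounded_op_adj S)+
  have Ici: "continuous_on {0..a} h" if "continuous_on {0..} h" for a and h :: "real \<Rightarrow> real"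
    by (rule continuous_on_subset[OF that]) auto
  have eps: "cmod (ip (S x) y) \<le> nrm (fc f ?A x) * nrm (fc g ?B y) + e * nrm x * nrm y" if e: "e > 0" for e
  proof -
    define u where "u t = 1 / (t + e)" for t
    define d where "d t = e / (t + e)" for t
    have u: "continuous_on {0..} u" and d: "continuous_on {0..} d"
      unfolding u_def d_def using e by (auto intro!: continuous_intros)
    have tu: "continuous_on {0..} (\<lambda>t. t * u t)" by (intro continuous_intros u)
    have td: "continuous_on {0..} (\<lambda>t. t * d t)" by (intro continuous_intros d)
    have uf: "continuous_on {0..} (\<lambda>t. u t * f t)" by (intro continuous_intros u f)
    have i: "continuous_on {0..} (\<lambda>t. t :: real)" by (intro continuous_intros)
    let ?w = "fc u ?A (fc f ?A x)"
    \<comment> \<open>By \<open>nrm_absop\<close> both this bound and the next reduce to scalar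
      functions on the half-line: \<open>t / (t + e)\<close> is at most 1 and
      \<open>t * e / (t + e)\<close> is at most \<open>e\<close>.\<close>
    have contraction: "nrm (S (fc u ?A z)) \<le> nrm z" for z
    proof -
      have "\<bar>t * u t\<bar> \<le> 1" if "0 \<le> t" for t using e that by (simp add: u_def)
      then have "nrm (fc (\<lambda>t. t * u t) ?A z) \<le> 1 * nrm z"
        by (intro fcalc_norm_le[OF A Ici[OF tu]]) auto
      then show ?thesis
        by (simp add: fcalc_mult[OF A Ici[OF i] Ici[OF u]] fcalc_ident[OF A] nrm_absop[OF S])
    qed
    have small: "nrm (S (fc d ?A x)) \<le> e * nrm x"
    proof -
      have "\<bar>t * d t\<bar> \<le> e" if "0 \<le> t" for t
        using e that by (simp add: d_def pos_divide_le_eq distrib_left)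
      then have "nrm (fc (\<lambda>t. t * d t) ?A x) \<le> e * nrm x"
        by (intro fcalc_norm_le[OF A Ici[OF td]]) auto
      then show ?thesis
        by (simp add: fcalc_mult[OF A Ici[OF i] Ici[OF d]] fcalc_ident[OF A] nrm_absop[OF S])
    qed
    have "fc (\<lambda>t. t * u t + d t) ?A = fc (\<lambda>t. 1) ?A"
      by (rule fcalc_cong) (use e in \<open>simp add: u_def d_def add_divide_distrib[symmetric]\<close>)
    then have x: "fc (\<lambda>t. t * u t) ?A x + fc d ?A x = x"
      using fcalc_add[OF A Ici[OF tu] Ici[OF d]] fcalc_one[OF A] by metis
    have "fc (\<lambda>t. t * u t) ?A = fc (\<lambda>t. g t * (u t * f t)) ?A"
      by (rule fcalc_cong) (use fg in \<open>simp add: mult_ac\<close>)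
    then have "fc (\<lambda>t. t * u t) ?A x = fc g ?A ?w"
      by (simp only: fcalc_mult[OF A Ici[OF g] Ici[OF uf]] fcalc_mult[OF A Ici[OF u] Ici[OF f]])
    then have "x = fc g ?A ?w + fc d ?A x" using x by simp
    then have "S x = S (fc g ?A ?w) + S (fc d ?A x)" using bounded_op_add[OF S] by metis
    \<comment> \<open>Crossing \<open>S\<close> turns \<open>g(|S|)\<close> into \<open>g\<close> of
      the other absolute value, which self-adjointness then moves onto \<open>y\<close>.\<close>
    also have "S (fc g ?A ?w) = fc g ?B (S ?w)"
      by (rule fcalc_intertwine[OF A B S, OF absop_intertwine[OF S] g])
    finally have Sx: "S x = fc g ?B (S ?w) + S (fc d ?A x)" .
    have "ip (S x) y = ip (S ?w) (fc g ?B y) + ip (S (fc d ?A x)) y"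
      unfolding Sx ip_add_left fcalc_selfadj[OF B Ici[OF g]] by (rule refl)
    then have "cmod (ip (S x) y) \<le> cmod (ip (S ?w) (fc g ?B y)) + cmod (ip (S (fc d ?A x)) y)"
      using norm_triangle_ineq by metis
    also have "\<dots> \<le> nrm (S ?w) * nrm (fc g ?B y) + nrm (S (fc d ?A x)) * nrm y"
      by (intro add_mono cauchy_schwarz)
    also have "\<dots> \<le> nrm (fc f ?A x) * nrm (fc g ?B y) + (e * nrm x) * nrm y"
      by (intro add_mono mult_right_mono contraction small) auto
    finally show ?thesis .
  qed
  show ?thesis
  proof (rule field_le_epsilon)
    fix e :: real assume e: "e > 0"
    have c: "nrm x * nrm y + 1 > 0" by (simp add: add_nonneg_pos)
    define d where "d = e / (nrm x * nrm y + 1)"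
    have d: "d > 0" using e c by (simp add: d_def)
    have "d * nrm x * nrm y \<le> d * (nrm x * nrm y + 1)" using d by (simp add: algebra_simps)
    also have "\<dots> = e" using c by (simp add: d_def)
    finally show "cmod (ip (S x) y) \<le> nrm (fc f ?A x) * nrm (fc g ?B y) + e"
      using eps[OF d] by linarith
  qed
qed

section \<open>Bounds for the matrix entries\<close>

lemma fcalc_sq_works:
  assumes P: "pos_op P" and h: "continuous_on {0..} h"
  shows bounded_op_fcalc_sq: "bounded_op (fcalc_sq sc ip h P)"
    and ip_fcalc_sq: "ip (fcalc_sq sc ip h P x) x = complex_of_real ((nrm (fc h P x))\<^sup>2)"
proof -
  have h': "continuous_on {0..opnorm ip P} h" by (rule continuous_on_subset[OF h]) auto
  show "bounded_op (fcalc_sq sc ip h P)"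
    unfolding fcalc_sq_def by (intro bounded_op_comp bounded_op_fcalc[OF P h'])
  show "ip (fcalc_sq sc ip h P x) x = complex_of_real ((nrm (fc h P x))\<^sup>2)"
    by (simp only: fcalc_sq_def comp_apply fcalc_selfadj[OF P h'] ip_self)
qed

lemma Re_ip_le_opnorm:
  assumes "bounded_op S"
  shows "Re (ip (S x) x) \<le> opnorm ip S * (nrm x)\<^sup>2"
proof -
  have "Re (ip (S x) x) \<le> nrm (S x) * nrm x"
    using cauchy_schwarz complex_Re_le_cmod order_trans by blast
  also have "\<dots> \<le> opnorm ip S * nrm x * nrm x"
    by (intro mult_right_mono opnorm_nonneg_bound assms) simp
  finally show ?thesis by (simp add: power2_eq_square mult.assoc)
qed

text \<open>Each factor of the mixed Schwarz inequality is estimated separately: its square is the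
  quadratic form of \<open>f\<^sup>2\<close> or \<open>g\<^sup>2\<close> of the absolute value,
  hence at most an operator norm times a square norm.\<close>

lemma ip_le_off_diagonal:
  assumes S: "bounded_op S"
    and f: "continuous_on {0..} f" and g: "continuous_on {0..} g"
    and fg: "\<And>t. t \<ge> 0 \<Longrightarrow> f t * g t = t"
  shows "cmod (ip (S x) y) \<le> sqrt (opnorm ip (fcalc_sq sc ip f (absop sc ip S)))
    * sqrt (opnorm ip (fcalc_sq sc ip g (absop sc ip (adj ip S)))) * nrm x * nrm y"
proof -
  have le: "nrm (fc h P z) \<le> sqrt (opnorm ip (fcalc_sq sc ip h P)) * nrm z"
    if P: "pos_op P" and h: "continuous_on {0..} h" for h P z
  proof -
    have "(nrm (fc h P z))\<^sup>2 \<le> opnorm ip (fcalc_sq sc ip h P) * (nrm z)\<^sup>2"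
      using Re_ip_le_opnorm[OF bounded_op_fcalc_sq[OF P h], of z] by (simp add: ip_fcalc_sq[OF P h])
    then show ?thesis using real_le_rsqrt by (fastforce simp: real_sqrt_mult)
  qed
  have A: "pos_op (absop sc ip S)" and B: "pos_op (absop sc ip (adj ip S))"
    by (intro pos_op_absop bounded_op_adj S)+
  have nn: "0 \<le> opnorm ip (fcalc_sq sc ip f (absop sc ip S))"
    by (rule opnorm_nonneg_bound(1)[OF bounded_op_fcalc_sq[OF A f]])
  show ?thesis
    using order_trans[OF mixed_schwarz[OF S f g fg, of x y] mult_mono[OF le[OF A f] le[OF B g]]] nn
    by (simp add: mult_ac)
qed

text \<open>With equal vectors the two square norms add up to the quadratic form of a single
  operator, so the norm of the sum appears; the factor \<open>1/2\<close> comes from the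
  arithmetic-geometric mean.\<close>

lemma ip_le_diagonal:
  assumes S: "bounded_op S"
    and f: "continuous_on {0..} f" and g: "continuous_on {0..} g"
    and fg: "\<And>t. t \<ge> 0 \<Longrightarrow> f t * g t = t"
  shows "cmod (ip (S x) x) \<le> (1/2) * opnorm ip (\<lambda>x. fcalc_sq sc ip f (absop sc ip S) x
    + fcalc_sq sc ip g (absop sc ip (adj ip S)) x) * nrm x * nrm x"
proof -
  let ?A = "absop sc ip S" and ?B = "absop sc ip (adj ip S)"
  let ?R = "\<lambda>x. fcalc_sq sc ip f ?A x + fcalc_sq sc ip g ?B x"
  have A: "pos_op ?A" and B: "pos_op ?B"
    by (intro pos_op_absop bounded_op_adj S)+
  have R: "bounded_op ?R"
    by (intro bounded_op_plus bounded_op_fcalc_sq A B f g)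
  have "2 * (nrm (fc f ?A x) * nrm (fc g ?B x)) \<le> (nrm (fc f ?A x))\<^sup>2 + (nrm (fc g ?B x))\<^sup>2"
    using sum_squares_bound[of "nrm (fc f ?A x)" "nrm (fc g ?B x)"] by (simp add: mult.assoc)
  also have "\<dots> = Re (ip (?R x) x)"
    by (simp add: ip_add_left ip_fcalc_sq[OF A f] ip_fcalc_sq[OF B g])
  also have "\<dots> \<le> opnorm ip ?R * (nrm x)\<^sup>2" by (rule Re_ip_le_opnorm[OF R])
  finally show ?thesis
    using mixed_schwarz[OF S f g fg, of x x] by (simp add: power2_eq_square)
qed

end

subsection \<open>Numerical radii\<close>

text \<open>\<open>Sup\<close> on the reals bounds its elements only for sets bounded above;
  coordinates of a unit vector have modulus at most 1, so the sum of all moduli of entries is a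
  crude bound.\<close>

lemma bdd_above_wmat:
  fixes M :: "nat \<Rightarrow> nat \<Rightarrow> complex"
  shows "bdd_above (insert 0 {cmod (\<Sum>i<n. \<Sum>j<n. M i j * z j * cnj (z i)) | z.
     (\<Sum>i<n. (cmod (z i))\<^sup>2) = 1})"
proof (rule bdd_aboveI)
  fix r assume "r \<in> insert 0 {cmod (\<Sum>i<n. \<Sum>j<n. M i j * z j * cnj (z i)) | z.
     (\<Sum>i<n. (cmod (z i))\<^sup>2) = 1}"
  then consider "r = 0" | z where "r = cmod (\<Sum>i<n. \<Sum>j<n. M i j * z j * cnj (z i))"
    "(\<Sum>i<n. (cmod (z i))\<^sup>2) = 1" by auto
  then show "r \<le> (\<Sum>i<n. \<Sum>j<n. cmod (M i j))"
  proof cases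
    case 1
    then show ?thesis by (simp add: sum_nonneg)
  next
    case 2
    have z1: "cmod (z i) \<le> 1" if "i < n" for i
    proof -
      have "(cmod (z i))\<^sup>2 \<le> (\<Sum>i<n. (cmod (z i))\<^sup>2)"
        by (rule member_le_sum) (use that in auto)
      then show ?thesis using 2 by (simp add: abs_square_le_1)
    qed
    have "r \<le> (\<Sum>i<n. \<Sum>j<n. cmod (M i j * z j * cnj (z i)))"
      unfolding 2 by (rule order_trans[OF norm_sum sum_mono[OF norm_sum]])
    also have "\<dots> \<le> (\<Sum>i<n. \<Sum>j<n. cmod (M i j))"
    proof (intro sum_mono)
      fix i j assume "i \<in> {..<n}" "j \<in> {..<n}"
      then have "cmod (M i j) * (cmod (z j) * cmod (z i)) \<le> cmod (M i j) * 1"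
        using z1 by (intro mult_left_mono mult_le_one) auto
      then show "cmod (M i j * z j * cnj (z i)) \<le> cmod (M i j)" by (simp add: norm_mult mult.assoc)
    qed
    finally show ?thesis .
  qed
qed

lemma wmat_nonneg: "0 \<le> wmat n M"
  unfolding wmat_def by (rule cSup_upper[OF _ bdd_above_wmat]) simp

lemma wmat_upper:
  assumes "(\<Sum>i<n. (cmod (z i))\<^sup>2) = 1"
  shows "cmod (\<Sum>i<n. \<Sum>j<n. M i j * z j * cnj (z i)) \<le> wmat n M"
  unfolding wmat_def by (rule cSup_upper[OF _ bdd_above_wmat]) (use assms in blast)

text \<open>The hypothesis speaks of a family \<open>x\<close> rather than of two free vectors, so
  that for \<open>i = j\<close> it concerns only values \<open>ip (T i i v) v\<close>, which is all
  that the diagonal bound controls.\<close>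

lemma wopmat_le_wmat:
  assumes m: "\<And>i j x. i < n \<Longrightarrow> j < n \<Longrightarrow>
    cmod (ip (T i j (x j)) (x i)) \<le> m i j * hnorm ip (x j) * hnorm ip (x i)"
  shows "wopmat ip n T \<le> wmat n (\<lambda>i j. complex_of_real (m i j))"
  unfolding wopmat_def
proof (rule cSup_least)
  fix r assume "r \<in> insert 0 {cmod (\<Sum>i<n. \<Sum>j<n. ip (T i j (x j)) (x i)) | x.
        (\<Sum>i<n. (hnorm ip (x i))\<^sup>2) = 1}"
  then consider "r = 0" | x where "r = cmod (\<Sum>i<n. \<Sum>j<n. ip (T i j (x j)) (x i))"
    "(\<Sum>i<n. (hnorm ip (x i))\<^sup>2) = 1" by auto
  then show "r \<le> wmat n (\<lambda>i j. complex_of_real (m i j))"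
  proof cases
    case 1
    then show ?thesis by (simp add: wmat_nonneg)
  next
    case 2
    define z where "z i = complex_of_real (hnorm ip (x i))" for i
    have "r \<le> (\<Sum>i<n. \<Sum>j<n. cmod (ip (T i j (x j)) (x i)))"
      unfolding 2 by (rule order_trans[OF norm_sum sum_mono[OF norm_sum]])
    also have "\<dots> \<le> (\<Sum>i<n. \<Sum>j<n. m i j * hnorm ip (x j) * hnorm ip (x i))"
      by (intro sum_mono m) auto
    also have "\<dots> \<le> cmod (complex_of_real (\<Sum>i<n. \<Sum>j<n. m i j * hnorm ip (x j) * hnorm ip (x i)))"
      by (simp only: norm_of_real abs_ge_self)
    also have "\<dots> = cmod (\<Sum>i<n. \<Sum>j<n. complex_of_real (m i j) * z j * cnj (z i))"
      by (simp add: z_def)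
    also have "\<dots> \<le> wmat n (\<lambda>i j. complex_of_real (m i j))"
      by (rule wmat_upper) (simp add: z_def 2)
    finally show ?thesis .
  qed
qed simp

theorem mainTheorem5:
  fixes sc :: "complex \<Rightarrow> 'a::ab_group_add \<Rightarrow> 'a"
    and ip :: "'a \<Rightarrow> 'a \<Rightarrow> complex"
    and n :: nat
    and T :: "nat \<Rightarrow> nat \<Rightarrow> 'a \<Rightarrow> 'a"
    and f g :: "real \<Rightarrow> real"
  assumes H: "chilbert sc ip"
    and n: "n \<ge> 1"
    and T: "\<And>i j. i < n \<Longrightarrow> j < n \<Longrightarrow> bop sc ip (T i j)"
    and fc: "continuous_on {0..} f" and gc: "continuous_on {0..} g"
    and fpos: "\<And>t. t \<ge> 0 \<Longrightarrow> f t \<ge> 0" and gpos: "\<And>t. t \<ge> 0 \<Longrightarrow> g t \<ge> 0"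
    and fg: "\<And>t. t \<ge> 0 \<Longrightarrow> f t * g t = t"
  shows "wopmat ip n T \<le> wmat n (\<lambda>i j.
     if i = j then complex_of_real ((1/2) * opnorm ip (\<lambda>x.
              fcalc_sq sc ip f (absop sc ip (T i i)) x + fcalc_sq sc ip g (absop sc ip (adj ip (T i i))) x))
     else complex_of_real (sqrt (opnorm ip (fcalc_sq sc ip f (absop sc ip (T i j))))
              * sqrt (opnorm ip (fcalc_sq sc ip g (absop sc ip (adj ip (T i j)))))))"
proof -
  interpret hilbert_space sc ip
  proof (intro hilbert_space.intro vector_space.intro hilbert_space_axioms.intro H)
    have "(\<forall>x. sc 1 x = x) \<and> (\<forall>a b x. sc a (sc b x) = sc (a * b) x) \<and>
      (\<forall>a x y. sc a (x + y) = sc a x + sc a y) \<and> (\<forall>a b x. sc (a + b) x = sc a x + sc b x)"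
      using H unfolding chilbert_def by (elim conjE) (intro conjI; assumption)
    then show "sc a (x + y) = sc a x + sc a y" "sc (a + b) x = sc a x + sc b x"
      "sc a (sc b x) = sc (a * b) x" "sc 1 x = x" for a b x y by blast+
  qed
  show ?thesis
    \<comment> \<open>Pulls \<open>complex_of_real\<close> out of the case distinction, giving the
      real entries \<open>m i j\<close> that the comparison expects.\<close>
    unfolding if_distrib[of complex_of_real, symmetric]
    by (rule wopmat_le_wmat) (use ip_le_diagonal[OF T fc gc fg] ip_le_off_diagonal[OF T fc gc fg] in simp)
qed

end
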